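(* For every $m,n\in\mathbb Z_+$ the map $\varphi_{m,n}\colon\mathbbm k\mathcal F(x_1,\dots,x_m)^{\otimes n}\to\mathcal P_{\mathbf{CocHopf}}(\mathbbm k)(m,n)$ is a linear bijection. Moreover, if $\mathcal F(x_1,x_2,\dots)$ is the free group of countable rank, then the (multilinear) polynomial identities with coefficients in $\mathbbm k$ of the group Hopf algebra $\mathbbm k\mathcal F(x_1,x_2,\dots)$ are generated by $V_{\mathbf{CocHopf}}$, i.e. (over the Hopf algebra axioms) by the cocommutativity identity $x_{(1)}\otimes x_{(2)}-x_{(2)}\otimes x_{(1)}\equiv0$.
   Context: $\mathbbm k$ is a field. Let $\Omega=\{\mu,u,\Delta,\varepsilon,S\}$ with $(s,t)$ equal to $(2,1),(0,1),(1,2),(1,0),(1,1)$ respectively. $\mathcal M(\Omega)$ is the free braided strict monoidal category on one object $1$ and morphisms $\omega\colon1^{\otimes s(\omega)}\to1^{\otimes t(\omega)}$ (objects $\mathbb Z_+$, $m\otimes n=m+n$, morphisms generated by identities, braidings $\tau_{m,n}$, their inverses and the $\omega$'s modulo the relations of a braided strict monoidal category); $\mathcal P(\mathbbm k,\Omega)(m,n)$ is the vector space with basis $\mathcal M(\Omega)(m,n)$. For a set $V\subseteq\mathcal P(\mathbbm k,\Omega)$, $\mathcal P_V(\mathbbm k,\Omega)$ is the quotient by the smallest monoidal ideal (subspaces of hom-spaces closed under composition on both sides and $\otimes$ with arbitrary morphisms) containing $V$. Every Hopf algebra $H$ is an $\Omega$-algebra and $\mathcal E_H\colon\mathcal P(\mathbbm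 k,\Omega)\to\mathbf{Vect}_{\mathbbm k}$ is the linear braided monoidal functor with $n\mapsto H^{\otimes n}$, $\omega\mapsto$ the corresponding structure map, $\tau_{m,n}\mapsto$ flip; $f\equiv0$ is a polynomial identity of $H$ if $\mathcal E_H(f)=0$, and $V$ generates the polynomial identities of $H$ if $\mathcal E_H$ vanishes on $V$ and every polynomial identity of $H$ has zero image in $\mathcal P_V(\mathbbm k,\Omega)$. $V_{\mathbf{Hopf}}$ consists of $\tau_{1,1}^2-\mathrm{id}_2$, $\mu(\mu\otimes\mathrm{id}_1)-\mu(\mathrm{id}_1\otimes\mu)$, $\mu(u\otimes\mathrm{id}_1)-\mathrm{id}_1$, $\mu(\mathrm{id}_1\otimes u)-\mathrm{id}_1$, $(\Delta\otimes\mathrm{id}_1)\Delta-(\mathrm{id}_1\otimes\Delta)\Delta$, $(\varepsilon\otimes\mathrm{id}_1)\Delta-\mathrm{id}_1$, $(\mathrm{id}_1\otimes\varepsilon)\Delta-\mathrm{id}_1$, $\varepsilon u-\mathrm{id}_0$, $\varepsilon\mu-\varepsilon\otimes\varepsilon$, $\Delta u-u\otimes u$, $\Delta\mu-(\mu\otimes\mu)(\mathrm{id}_1\otimes\tau_{1,1}\otimes\mathrm{id}_1)(\Delta\otimes\Delta)$, $\mu(S\otimes\mathrm{id}_1)\Delta-u\varepsilon$, $\mu(\mathrm{id}_1\otimes S)\Delta-u\varepsilon$. $V_{\mathbf{CocHopf}}:=V_{\mathbf{Hopf}}\cup\{\Delta-\tau_{1,1}\Delta\}$ and $\mathcal P_{\mathbf{CocHopf}}(\mathbbm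 k):=\mathcal P_{V_{\mathbf{CocHopf}}}(\mathbbm k,\Omega)$. Functional notation: in $\mathcal P_{\mathbf{CocHopf}}(\mathbbm k)(m,n)$ (which is symmetric since $\tau_{1,1}^2=\mathrm{id}_2$ holds), an expression in variables $x_1,\dots,x_m$ denotes the morphism that first applies to the $q$-th input $\varepsilon$ if $\varepsilon(x_q)$ is written, or the iterated comultiplication $(\Delta\otimes\mathrm{id}_{p-2})\cdots(\Delta\otimes\mathrm{id}_1)\Delta$ producing $x_{q(1)}\otimes\dots\otimes x_{q(p)}$ (with $x_{q(1)}:=x_q$ if $p=1$), then permutes tensor factors by symmetric braidings, applies $S$ where indicated, multiplies juxtaposed factors with $\mu$, and uses $u$ for an empty product. $\mathcal F(x_1,\dots,x_m)$ is the free group; its group algebra has the standard basis of tensors $w_1\otimes\dots\otimes w_n$ of group elements written as reduced words. $\varphi_{m,n}(w_1\otimes\dots\otimes w_n)$ is obtained by: replacing every letter $x_j^{-1}$ by $Sx_j$ (a power $x_j^{\pm k}$ being written as $k$ letters); if $x_j$ occurs (with either sign) more than once in total, replacing its $r$-th occurrence (counted left to right through $w_1,\dots,w_n$) by $x_{j(r)}$; if $x_j$ does not occur, prefixing the factor $\varepsilon(x_j)$; the tensor factor for $w_i=1$ is $u$. $\varphi_{m,n}$ is extended linearly. E.g. $\varphi_{5,2}(x_1x_2x_1^{-1}\otimes x_5x_2^{-1}x_1^2)=\varepsilon(x_3)\varepsilon(x_4)\,x_{1(1)}x_{2(1)}Sx_{1(2)}\otimes x_5(Sx_{2(2)})x_{1(3)}x_{1(4)}$.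 *)

theory Defs
  imports Main
begin

datatype gen = GMu | GUn | GDl | GEp | GAn

fun gsrc :: "gen \<Rightarrow> nat" where
  "gsrc GMu = 2" | "gsrc GUn = 0" | "gsrc GDl = 1" | "gsrc GEp = 1" | "gsrc GAn = 1"

fun gtgt :: "gen \<Rightarrow> nat" where
  "gtgt GMu = 1" | "gtgt GUn = 1" | "gtgt GDl = 2" | "gtgt GEp = 0" | "gtgt GAn = 1"

text \<open>Terms: Comp f g is f composed after g (g applied first); Br m n is the braiding
  tau_{m,n} : m+n -> n+m; BrInv m n is its inverse, n+m -> m+n.\<close>
datatype tm = Id nat | Br nat nat | BrInv nat nat | Gen gen | Comp tm tm | Tens tm tm

inductive typed :: "tm \<Rightarrow> nat \<Rightarrow> nat \<Rightarrow> bool" where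
  ty_id: "typed (Id n) n n"
| ty_br: "typed (Br m n) (m + n) (n + m)"
| ty_brinv: "typed (BrInv m n) (n + m) (m + n)"
| ty_gen: "typed (Gen g) (gsrc g) (gtgt g)"
| ty_comp: "typed g m k \<Longrightarrow> typed f k n \<Longrightarrow> typed (Comp f g) m n"
| ty_tens: "typed f m n \<Longrightarrow> typed g p q \<Longrightarrow> typed (Tens f g) (m + p) (n + q)"

text \<open>The relations of a braided strict monoidal category (equality of morphisms of M(Omega)).\<close>
inductive eqv :: "tm \<Rightarrow> tm \<Rightarrow> bool" where
  eq_refl: "typed t m n \<Longrightarrow> eqv t t"
| eq_sym: "eqv s t \<Longrightarrow> eqv t s"
| eq_trans: "eqv s t \<Longrightarrow> eqv t u \<Longrightarrow> eqv s u"
| eq_comp: "eqv f f' \<Longrightarrow> eqv g g' \<Longrightarrow> typed g m k \<Longrightarrow> typed f k n \<Longrightarrow>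
            eqv (Comp f g) (Comp f' g')"
| eq_tens: "eqv f f' \<Longrightarrow> eqv g g' \<Longrightarrow> typed f m n \<Longrightarrow> typed g p q \<Longrightarrow>
            eqv (Tens f g) (Tens f' g')"
| eq_id_l: "typed f m n \<Longrightarrow> eqv (Comp (Id n) f) f"
| eq_id_r: "typed f m n \<Longrightarrow> eqv (Comp f (Id m)) f"
| eq_comp_assoc: "typed h m k \<Longrightarrow> typed g k l \<Longrightarrow> typed f l n \<Longrightarrow>
            eqv (Comp (Comp f g) h) (Comp f (Comp g h))"
| eq_tens_assoc: "typed f a b \<Longrightarrow> typed g c d \<Longrightarrow> typed h e i \<Longrightarrow>
            eqv (Tens (Tens f g) h) (Tens f (Tens g h))"
| eq_unit_l: "typed f m n \<Longrightarrow> eqv (Tens (Id 0) f) f"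
| eq_unit_r: "typed f m n \<Longrightarrow> eqv (Tens f (Id 0)) f"
| eq_tens_id: "eqv (Tens (Id m) (Id n)) (Id (m + n))"
| eq_interchange: "typed f a b \<Longrightarrow> typed f' b c \<Longrightarrow> typed g a' b' \<Longrightarrow> typed g' b' c' \<Longrightarrow>
            eqv (Comp (Tens f' g') (Tens f g)) (Tens (Comp f' f) (Comp g' g))"
| eq_br_inv1: "eqv (Comp (Br m n) (BrInv m n)) (Id (n + m))"
| eq_br_inv2: "eqv (Comp (BrInv m n) (Br m n)) (Id (m + n))"
| eq_br_nat: "typed f m m' \<Longrightarrow> typed g n n' \<Longrightarrow>
            eqv (Comp (Br m' n') (Tens f g)) (Comp (Tens g f) (Br m n))"
| eq_hex1: "eqv (Br l (m + n)) (Comp (Tens (Id m) (Br l n)) (Tens (Br l m) (Id n)))"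
| eq_hex2: "eqv (Br (l + m) n) (Comp (Tens (Br l n) (Id m)) (Tens (Id l) (Br m n)))"

text \<open>GAn element of P(k,Omega)(m,n) is represented by a finitely supported linear
  combination of terms of type m -> n.\<close>
definition in_P :: "nat \<Rightarrow> nat \<Rightarrow> (tm \<Rightarrow> 'k::field) \<Rightarrow> bool" where
  "in_P m n f \<longleftrightarrow> finite {t. f t \<noteq> 0} \<and> (\<forall>t. f t \<noteq> 0 \<longrightarrow> typed t m n)"

definition lc :: "tm \<Rightarrow> tm \<Rightarrow> 'k::field" where
  "lc t = (\<lambda>s. if s = t then 1 else 0)"

definition postc :: "tm \<Rightarrow> (tm \<Rightarrow> 'k::field) \<Rightarrow> tm \<Rightarrow> 'k" where
  "postc h f = (\<lambda>s. case s of Comp h' t \<Rightarrow> if h' = h then f t else 0 | _ \<Rightarrow> 0)"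

definition prec :: "(tm \<Rightarrow> 'k::field) \<Rightarrow> tm \<Rightarrow> tm \<Rightarrow> 'k" where
  "prec f h = (\<lambda>s. case s of Comp t h' \<Rightarrow> if h' = h then f t else 0 | _ \<Rightarrow> 0)"

definition tensl :: "tm \<Rightarrow> (tm \<Rightarrow> 'k::field) \<Rightarrow> tm \<Rightarrow> 'k" where
  "tensl h f = (\<lambda>s. case s of Tens h' t \<Rightarrow> if h' = h then f t else 0 | _ \<Rightarrow> 0)"

definition tensr :: "(tm \<Rightarrow> 'k::field) \<Rightarrow> tm \<Rightarrow> tm \<Rightarrow> 'k" where
  "tensr f h = (\<lambda>s. case s of Tens t h' \<Rightarrow> if h' = h then f t else 0 | _ \<Rightarrow> 0)"

text \<open>The smallest monoidal ideal containing V, pulled back to linear combinations of terms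
  (it also contains the differences of terms equal in M(Omega), so that membership
  means: zero in the quotient P_V(k,Omega)).\<close>
inductive_set ideal :: "(nat \<times> nat \<times> (tm \<Rightarrow> 'k::field)) set \<Rightarrow> (nat \<times> nat \<times> (tm \<Rightarrow> 'k)) set"
  for V where
  id_gen: "(m, n, v) \<in> V \<Longrightarrow> (m, n, v) \<in> ideal V"
| id_eqv: "typed t m n \<Longrightarrow> eqv t t' \<Longrightarrow> (m, n, \<lambda>s. lc t s - lc t' s) \<in> ideal V"
| id_zero: "(m, n, \<lambda>s. 0) \<in> ideal V"
| id_add: "(m, n, f) \<in> ideal V \<Longrightarrow> (m, n, g) \<in> ideal V \<Longrightarrow> (m, n, \<lambda>s. f s + g s) \<in> ideal V"
| id_smult: "(m, n, f) \<in> ideal V \<Longrightarrow> (m, n, \<lambda>s. c * f s) \<in> ideal V"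
| id_postc: "(m, n, f) \<in> ideal V \<Longrightarrow> typed h n p \<Longrightarrow> (m, p, postc h f) \<in> ideal V"
| id_prec: "(m, n, f) \<in> ideal V \<Longrightarrow> typed h p m \<Longrightarrow> (p, n, prec f h) \<in> ideal V"
| id_tensl: "(m, n, f) \<in> ideal V \<Longrightarrow> typed h p q \<Longrightarrow> (p + m, q + n, tensl h f) \<in> ideal V"
| id_tensr: "(m, n, f) \<in> ideal V \<Longrightarrow> typed h p q \<Longrightarrow> (m + p, n + q, tensr f h) \<in> ideal V"

definition cls :: "(nat \<times> nat \<times> (tm \<Rightarrow> 'k::field)) set \<Rightarrow> nat \<Rightarrow> nat \<Rightarrow> (tm \<Rightarrow> 'k) \<Rightarrow> (tm \<Rightarrow> 'k) set" where
  "cls V m n f = {g. in_P m n g \<and> (m, n, \<lambda>s. f s - g s) \<in> ideal V}"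

definition PV :: "(nat \<times> nat \<times> (tm \<Rightarrow> 'k::field)) set \<Rightarrow> nat \<Rightarrow> nat \<Rightarrow> (tm \<Rightarrow> 'k) set set" where
  "PV V m n = cls V m n ` {f. in_P m n f}"

definition df :: "tm \<Rightarrow> tm \<Rightarrow> tm \<Rightarrow> 'k::field" where
  "df a b = (\<lambda>s. lc a s - lc b s)"

abbreviation "mu \<equiv> Gen GMu"
abbreviation "uu \<equiv> Gen GUn"
abbreviation "De \<equiv> Gen GDl"
abbreviation "ep \<equiv> Gen GEp"
abbreviation "SS \<equiv> Gen GAn"

definition V_Hopf :: "(nat \<times> nat \<times> (tm \<Rightarrow> 'k::field)) set" where
  "V_Hopf = {
    (2, 2, df (Comp (Br 1 1) (Br 1 1)) (Id 2)),
    (3, 1, df (Comp mu (Tens mu (Id 1))) (Comp mu (Tens (Id 1) mu))),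
    (1, 1, df (Comp mu (Tens uu (Id 1))) (Id 1)),
    (1, 1, df (Comp mu (Tens (Id 1) uu)) (Id 1)),
    (1, 3, df (Comp (Tens De (Id 1)) De) (Comp (Tens (Id 1) De) De)),
    (1, 1, df (Comp (Tens ep (Id 1)) De) (Id 1)),
    (1, 1, df (Comp (Tens (Id 1) ep) De) (Id 1)),
    (0, 0, df (Comp ep uu) (Id 0)),
    (2, 0, df (Comp ep mu) (Tens ep ep)),
    (0, 2, df (Comp De uu) (Tens uu uu)),
    (2, 2, df (Comp De mu)
              (Comp (Tens mu mu) (Comp (Tens (Tens (Id 1) (Br 1 1)) (Id 1)) (Tens De De)))),
    (1, 1, df (Comp mu (Comp (Tens SS (Id 1)) De)) (Comp uu ep)),
    (1, 1, df (Comp mu (Comp (Tens (Id 1) SS) De)) (Comp uu ep))}"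

definition V_CocHopf :: "(nat \<times> nat \<times> (tm \<Rightarrow> 'k::field)) set" where
  "V_CocHopf = V_Hopf \<union> {(1, 2, df De (Comp (Br 1 1) De))}"

text \<open>A letter (j, True) is x_j, (j, False) is x_j^{-1}.\<close>
type_synonym letter = "nat \<times> bool"
type_synonym word = "letter list"

fun reduced :: "word \<Rightarrow> bool" where
  "reduced (a # b # w) = (\<not> (fst a = fst b \<and> snd a \<noteq> snd b) \<and> reduced (b # w))"
| "reduced _ = True"

fun push :: "letter \<Rightarrow> word \<Rightarrow> word" where
  "push a [] = [a]"
| "push a (b # w) = (if fst a = fst b \<and> snd a \<noteq> snd b then w else a # b # w)"

definition wmul :: "word \<Rightarrow> word \<Rightarrow> word" where
  "wmul u v = foldr push u v"

definition winv :: "word \<Rightarrow> word" where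
  "winv w = rev (map (\<lambda>(j, b). (j, \<not> b)) w)"

definition Fword :: "nat \<Rightarrow> word \<Rightarrow> bool" where
  "Fword m w \<longleftrightarrow> reduced w \<and> (\<forall>l \<in> set w. 1 \<le> fst l \<and> fst l \<le> m)"

text \<open>Elements of kF(x_1..x_m)^{tensor n}: finitely supported combinations of the standard
  basis tensors w_1 x ... x w_n (lists of n reduced words).\<close>
definition in_A :: "nat \<Rightarrow> nat \<Rightarrow> (word list \<Rightarrow> 'k::field) \<Rightarrow> bool" where
  "in_A m n a \<longleftrightarrow> finite {ws. a ws \<noteq> 0} \<and>
     (\<forall>ws. a ws \<noteq> 0 \<longrightarrow> length ws = n \<and> (\<forall>w \<in> set ws. Fword m w))"

definition tens_list :: "tm list \<Rightarrow> tm" where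
  "tens_list ts = foldr Tens ts (Id 0)"

fun diag :: "nat \<Rightarrow> tm" where
  "diag 0 = ep"
| "diag (Suc 0) = Id 1"
| "diag (Suc (Suc k)) = Comp (Tens De (Id k)) (diag (Suc k))"

fun mult :: "nat \<Rightarrow> tm" where
  "mult 0 = uu"
| "mult (Suc 0) = Id 1"
| "mult (Suc (Suc k)) = Comp mu (Tens (mult (Suc k)) (Id 1))"

definition pos :: "'a \<Rightarrow> 'a list \<Rightarrow> nat" where
  "pos x xs = length (takeWhile (\<lambda>y. y \<noteq> x) xs)"

text \<open>perm cur tgt: a braid term permuting wires labelled by cur (distinct labels) into
  the order tgt.\<close>
fun perm :: "'a list \<Rightarrow> 'a list \<Rightarrow> tm" where
  "perm cur [] = Id 0"
| "perm cur (t # ts) =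
     Comp (Tens (Id 1) (perm (remove1 t cur) ts))
          (Tens (Br (pos t cur) 1) (Id (length cur - pos t cur - 1)))"

definition occ :: "word list \<Rightarrow> nat \<Rightarrow> nat" where
  "occ ws j = length (filter (\<lambda>l. fst l = j) (concat ws))"

text \<open>label (j, r) of the r-th occurrence of x_j, in order of occurrence\<close>
definition occ_labels :: "word list \<Rightarrow> (nat \<times> nat) list" where
  "occ_labels ws = (let L = concat ws in
     map (\<lambda>p. (fst (L ! p), Suc (length (filter (\<lambda>l. fst l = fst (L ! p)) (take p L)))))
         [0..<length L])"

definition sorted_labels :: "nat \<Rightarrow> word list \<Rightarrow> (nat \<times> nat) list" where
  "sorted_labels m ws = concat (map (\<lambda>j. map (\<lambda>r. (j, r)) [1..<Suc (occ ws j)]) [1..<Suc m])"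

definition phi_term :: "nat \<Rightarrow> word list \<Rightarrow> tm" where
  "phi_term m ws =
     Comp (tens_list (map (\<lambda>w. mult (length w)) ws))
      (Comp (tens_list (map (\<lambda>l. if snd l then Id 1 else SS) (concat ws)))
       (Comp (perm (sorted_labels m ws) (occ_labels ws))
             (tens_list (map (\<lambda>j. diag (occ ws j)) [1..<Suc m]))))"

definition phi_lin :: "nat \<Rightarrow> (word list \<Rightarrow> 'k::field) \<Rightarrow> tm \<Rightarrow> 'k" where
  "phi_lin m a = (\<lambda>t. \<Sum>ws \<in> {ws. a ws \<noteq> 0}. if phi_term m ws = t then a ws else 0)"

text \<open>Every structure map of a group algebra maps basis tensors (tuples of group elements)
  to basis tensors; eval t describes E_H(t) on the basis of H^{tensor m}.\<close>
fun gsem :: "gen \<Rightarrow> word list \<Rightarrow> word list" where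
  "gsem GMu xs = [wmul (xs ! 0) (xs ! 1)]"
| "gsem GUn xs = [[]]"
| "gsem GDl xs = [xs ! 0, xs ! 0]"
| "gsem GEp xs = []"
| "gsem GAn xs = [winv (xs ! 0)]"

fun src :: "tm \<Rightarrow> nat" where
  "src (Id n) = n"
| "src (Br m n) = m + n"
| "src (BrInv m n) = n + m"
| "src (Gen g) = gsrc g"
| "src (Comp f g) = src g"
| "src (Tens f g) = src f + src g"

fun eval :: "tm \<Rightarrow> word list \<Rightarrow> word list" where
  "eval (Id n) xs = xs"
| "eval (Br m n) xs = drop m xs @ take m xs"
| "eval (BrInv m n) xs = drop n xs @ take n xs"
| "eval (Gen g) xs = gsem g xs"
| "eval (Comp f g) xs = eval f (eval g xs)"
| "eval (Tens f g) xs = eval f (take (src f) xs) @ eval g (drop (src f) xs)"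

text \<open>f (in P(k,Omega)(m,n)) is a polynomial identity of kF(x_1,x_2,...): E_H(f) = 0,
  i.e. E_H(f) vanishes on every basis tensor of H^{tensor m}.\<close>
definition poly_id :: "nat \<Rightarrow> nat \<Rightarrow> (tm \<Rightarrow> 'k::field) \<Rightarrow> bool" where
  "poly_id m n f \<longleftrightarrow> (\<forall>xs. length xs = m \<and> (\<forall>x \<in> set xs. reduced x) \<longrightarrow>
      (\<forall>ys. (\<Sum>t \<in> {t. f t \<noteq> 0}. if eval t xs = ys then f t else 0) = 0))"

end

(* The relations make the quotient category cartesian: tensor products of cocommutative comonoids
   are cocommutative comonoids, and all generators (for S this is the usual convolution-inverse
   argument) are comonoid morphisms on the projections and their products. Hence Hom(k, 1) contains
   a group under convolution, generated by the projections, so that a tuple ws of words in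
   x_1, ..., x_k gives a morphism Phi_k(ws), and t o Phi_k(ws) = Phi_k(eval t ws) for every term t.
   As Phi_m(x_1, ..., x_m) is the identity, a term is determined modulo the ideal by its value at
   the generators. No coherence for the braidings in phi is needed: phi(ws) evaluates to ws, hence
   equals every term with that value. *)

theory Submission
  imports Defs
begin

subsection \<open>The free group on reduced words\<close>

text \<open>The overview treats one direction, from equal values to equality modulo the ideal. The
  converse is \<open>ideal_vanishes\<close>: every member of the ideal evaluates to zero on all
  tuples of reduced words. The two meet in \<open>nf\<close>, which regroups the coefficients of a
  combination by the values of its terms at \<open>gens m\<close>. It is a left inverse of
  \<open>phi_lin\<close>, and a combination differs from the \<open>phi_lin\<close> image of its
  \<open>nf\<close> by a member of the ideal; this gives injectivity and surjectivity. A polynomial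
  identity has \<open>nf\<close> zero, because the generators are themselves one of the tuples on
  which it must vanish; countable rank puts \<open>gens m\<close> for every \<open>m\<close> into
  one group. Cocommutativity is decisive at one point, \<open>coc_comonoid_four\<close>: the two
  middle copies of a fourfold copy may be exchanged. In a general Hopf algebra the antipode reverses
  the comultiplication, and a convolution product of comonoid morphisms need not be one; the
  exchange repairs both, so that the group-like maps form a group.\<close>

definition linv :: "letter \<Rightarrow> letter" where
  "linv l = (fst l, \<not> snd l)"

lemma linv_linv [simp]: "linv (linv l) = l"
  by (simp add: linv_def)

text \<open>Turns the cancellation test of \<open>push\<close> and \<open>reduced\<close> into an
  equation that can be substituted; the original simp rule of \<open>push\<close> is therefore
  switched off in favour of \<open>push_Cons\<close>.\<close>

lemma cancels_iff: "fst a = fst b \<and> snd a \<noteq> snd b \<longleftrightarrow> b = linv a"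
  by (auto simp: linv_def prod_eq_iff)

lemma reduced_Cons: "reduced (a # w) \<longleftrightarrow> reduced w \<and> (w = [] \<or> hd w \<noteq> linv a)"
  using cancels_iff[of a "hd w"] by (cases w) auto

lemma push_Cons: "push a (b # w) = (if b = linv a then w else a # b # w)"
  using cancels_iff[of a b] by simp

lemma reduced_push: "reduced w \<Longrightarrow> reduced (push a w)"
  by (cases w) (auto simp del: push.simps(2) simp add: push_Cons reduced_Cons)

lemma push_reduced: "reduced (a # w) \<Longrightarrow> push a w = a # w"
  by (cases w) (auto simp del: push.simps(2) simp add: push_Cons reduced_Cons)

text \<open>Van der Waerden's argument: letters act on the set of reduced words by mutually inverse
  permutations, and associativity of \<open>wmul\<close> is inherited from this action. If
  \<open>w\<close> starts with \<open>a\<close>, reducedness prevents a second cancellation when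
  \<open>a\<close> is pushed back.\<close>

lemma push_linv: "reduced w \<Longrightarrow> push a (push (linv a) w) = w"
  by (cases w) (auto simp del: push.simps(2) simp add: push_Cons reduced_Cons push_reduced)

lemma wmul_Nil_left [simp]: "wmul [] v = v"
  by (simp add: wmul_def)

lemma wmul_Cons: "wmul (a # u) v = push a (wmul u v)"
  by (simp add: wmul_def)

lemma wmul_append: "wmul (u @ v) w = wmul u (wmul v w)"
  by (simp add: wmul_def)

lemma reduced_wmul: "reduced v \<Longrightarrow> reduced (wmul u v)"
  by (induction u) (auto simp: wmul_Cons reduced_push)

lemma wmul_reduced_append: "reduced (u @ v) \<Longrightarrow> wmul u v = u @ v"
  by (induction u) (auto simp: wmul_Cons reduced_Cons push_reduced)

lemma wmul_Nil_right: "reduced u \<Longrightarrow> wmul u [] = u"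
  using wmul_reduced_append[of u "[]"] by simp

lemma wmul_push: "reduced v \<Longrightarrow> wmul (push a u) v = push a (wmul u v)"
  by (cases u)
     (auto simp del: push.simps(2) simp add: wmul_Cons push_Cons push_linv reduced_wmul)

lemma wmul_assoc: "reduced w \<Longrightarrow> wmul (wmul u v) w = wmul u (wmul v w)"
  by (induction u) (auto simp: wmul_Cons wmul_push)

lemma winv_def': "winv w = rev (map linv w)"
  by (simp add: winv_def linv_def case_prod_beta')

lemma winv_Cons: "winv (a # w) = winv w @ [linv a]"
  by (simp add: winv_def')

lemma winv_winv [simp]: "winv (winv w) = w"
  by (simp add: winv_def' rev_map o_def)

text \<open>A left-right symmetric form of reducedness, compatible with \<open>rev\<close>,
  \<open>map\<close> and splitting at the right end.\<close>

lemma reduced_eq_successively: "reduced w \<longleftrightarrow> successively (\<lambda>a b. b \<noteq> linv a) w"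
  by (induction w) (auto simp: reduced_Cons successively_Cons)

lemma reduced_winv: "reduced w \<Longrightarrow> reduced (winv w)"
  unfolding reduced_eq_successively winv_def'
  by (simp add: successively_map) (erule successively_mono, auto)

lemma wmul_winv_left: "reduced w \<Longrightarrow> wmul (winv w) w = []"
  by (induction w)
     (auto simp: winv_def' wmul_append wmul_Cons reduced_Cons push_Cons
           simp del: push.simps(2))

lemma wmul_winv_right: "reduced w \<Longrightarrow> wmul w (winv w) = []"
  using wmul_winv_left[of "winv w"] reduced_winv by simp

lemma set_push: "set (push a w) \<subseteq> insert a (set w)"
  by (cases w) auto

lemma set_wmul: "set (wmul u v) \<subseteq> set u \<union> set v"
  by (induction u) (use set_push in \<open>fastforce simp: wmul_Cons\<close>)+

lemma Fword_wmul: "Fword m u \<Longrightarrow> Fword m v \<Longrightarrow> Fword m (wmul u v)"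
  using set_wmul[of u v] by (auto simp: Fword_def reduced_wmul)

lemma Fword_winv: "Fword m w \<Longrightarrow> Fword m (winv w)"
  using reduced_winv[of w] by (auto simp: Fword_def winv_def' linv_def)


subsection \<open>Terms and their evaluation\<close>

fun tgt :: "tm \<Rightarrow> nat" where
  "tgt (Id n) = n"
| "tgt (Br m n) = n + m"
| "tgt (BrInv m n) = m + n"
| "tgt (Gen g) = gtgt g"
| "tgt (Comp f g) = tgt f"
| "tgt (Tens f g) = tgt f + tgt g"

fun wf_tm :: "tm \<Rightarrow> bool" where
  "wf_tm (Comp f g) \<longleftrightarrow> wf_tm f \<and> wf_tm g \<and> src f = tgt g"
| "wf_tm (Tens f g) \<longleftrightarrow> wf_tm f \<and> wf_tm g"
| "wf_tm _ \<longleftrightarrow> True"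

lemma typed_imp_wf_tm: "typed t m n \<Longrightarrow> wf_tm t \<and> src t = m \<and> tgt t = n"
  by (induction rule: typed.induct) auto

lemma wf_tm_imp_typed: "wf_tm t \<Longrightarrow> typed t (src t) (tgt t)"
  by (induction t) (auto intro: typed.intros)

text \<open>Types are unique, so typing can be decided by rewriting with recursive functions instead
  of by inductive rules.\<close>

lemma typed_iff: "typed t m n \<longleftrightarrow> wf_tm t \<and> src t = m \<and> tgt t = n"
  using typed_imp_wf_tm wf_tm_imp_typed by blast

lemma length_eval: "wf_tm t \<Longrightarrow> length xs = src t \<Longrightarrow> length (eval t xs) = tgt t"
proof (induction t arbitrary: xs)
  case (Gen g)
  then show ?case by (cases g) auto
qed auto

text \<open>Structure maps use only the group operations, so a predicate that is closed under them
  propagates. It is applied to reduced words and to words in the first \<open>m\<close>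
  letters.\<close>

lemma eval_closed:
  assumes "P []" "\<And>u v. P u \<Longrightarrow> P v \<Longrightarrow> P (wmul u v)" "\<And>u. P u \<Longrightarrow> P (winv u)"
  shows "wf_tm t \<Longrightarrow> length xs = src t \<Longrightarrow> \<forall>x \<in> set xs. P x \<Longrightarrow> \<forall>x \<in> set (eval t xs). P x"
proof (induction t arbitrary: xs)
  case (Gen g)
  then have "P (xs ! i)" if "i < gsrc g" for i
    using that by auto
  then show ?case
    by (cases g) (use assms in auto)
next
  case (Tens f g)
  have "\<forall>x \<in> set (eval f (take (src f) xs)). P x"
    using Tens.prems by (intro Tens.IH(1)) (auto dest: in_set_takeD)
  moreover have "\<forall>x \<in> set (eval g (drop (src f) xs)). P x"
    using Tens.prems by (intro Tens.IH(2)) (auto dest: in_set_dropD)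
  ultimately show ?case by auto
next
  case (Comp f g)
  have "\<forall>x \<in> set (eval g xs). P x"
    using Comp.prems by (intro Comp.IH(2)) auto
  moreover have "length (eval g xs) = src f"
    using Comp.prems by (simp add: length_eval)
  ultimately have "\<forall>x \<in> set (eval f (eval g xs)). P x"
    using Comp.prems by (intro Comp.IH(1)) auto
  then show ?case by simp
qed (auto dest: in_set_takeD in_set_dropD)

lemma eval_reduced:
  "wf_tm t \<Longrightarrow> length xs = src t \<Longrightarrow> \<forall>x \<in> set xs. reduced x \<Longrightarrow> \<forall>x \<in> set (eval t xs). reduced x"
  by (rule eval_closed) (auto simp: reduced_wmul reduced_winv)

lemma eval_Fword:
  "wf_tm t \<Longrightarrow> length xs = src t \<Longrightarrow> \<forall>x \<in> set xs. Fword m x \<Longrightarrow> \<forall>x \<in> set (eval t xs). Fword m x"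
  by (rule eval_closed) (auto simp: Fword_wmul Fword_winv, simp add: Fword_def)

lemma drop_split: "drop l xs = drop l (take (l + m) xs) @ drop (l + m) xs"
proof -
  have "drop l xs = take m (drop l xs) @ drop m (drop l xs)"
    by (simp only: append_take_drop_id)
  then show ?thesis by (simp add: drop_take add.commute)
qed

text \<open>The braiding acts as the flip of blocks, and the structural relations merely rearrange
  entries of a tuple; group laws enter only in \<open>coc_rel_eval\<close>.\<close>

lemma eqv_sound:
  "eqv s t \<Longrightarrow> wf_tm s \<and> wf_tm t \<and> src s = src t \<and> tgt s = tgt t \<and>
     (\<forall>xs. length xs = src s \<longrightarrow> eval s xs = eval t xs)"
proof (induction rule: eqv.induct)
  case (eq_br_nat f m m' g n n')
  then show ?case by (auto simp: typed_iff length_eval)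
next
  case (eq_interchange f a b f' c g a' b' g' c')
  then show ?case by (auto simp: typed_iff length_eval)
next
  case (eq_hex1 l m n)
  have "drop l xs = drop l (take (l + m) xs) @ drop (l + m) xs" if "length xs = l + (m + n)"
    for xs :: "word list"
    by (rule drop_split)
  then show ?case by (auto simp: take_drop add.commute min_def)
next
  case (eq_hex2 l m n)
  have "take (l + m) xs = take l xs @ drop l (take (l + m) xs)" for xs :: "word list"
    using append_take_drop_id[of l "take (l + m) xs"] by simp
  then show ?case by (auto simp: take_drop add.commute min_def)
qed (auto simp: typed_iff length_eval take_drop add.commute)


subsection \<open>The quotient category\<close>

text \<open>The defining differences are kept as pairs of terms so that they can generate a
  congruence on terms.\<close>

definition coc_rel :: "(tm \<times> tm) set" where
  "coc_rel = {
    (De, Comp (Br 1 1) De),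
    (Comp (Br 1 1) (Br 1 1), Id 2),
    (Comp mu (Tens mu (Id 1)), Comp mu (Tens (Id 1) mu)),
    (Comp mu (Tens uu (Id 1)), Id 1),
    (Comp mu (Tens (Id 1) uu), Id 1),
    (Comp (Tens De (Id 1)) De, Comp (Tens (Id 1) De) De),
    (Comp (Tens ep (Id 1)) De, Id 1),
    (Comp (Tens (Id 1) ep) De, Id 1),
    (Comp ep uu, Id 0),
    (Comp ep mu, Tens ep ep),
    (Comp De uu, Tens uu uu),
    (Comp De mu, Comp (Tens mu mu) (Comp (Tens (Tens (Id 1) (Br 1 1)) (Id 1)) (Tens De De))),
    (Comp mu (Comp (Tens SS (Id 1)) De), Comp uu ep),
    (Comp mu (Comp (Tens (Id 1) SS) De), Comp uu ep)}"

lemma V_CocHopf_eq: "V_CocHopf = (\<lambda>(s, t). (src s, tgt s, df s t)) ` coc_rel"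
  by (simp add: V_CocHopf_def V_Hopf_def coc_rel_def numeral_eq_Suc)

lemma coc_rel_wf:
  "(s, t) \<in> coc_rel \<Longrightarrow> wf_tm s \<and> wf_tm t \<and> src s = src t \<and> tgt s = tgt t"
  by (auto simp: coc_rel_def)

text \<open>Ill-typed terms are kept on purpose: then source, target and both products are total on
  the quotient, and associativity and naturality hold there without side conditions.\<close>

inductive ceq :: "tm \<Rightarrow> tm \<Rightarrow> bool" where
  refl: "ceq t t"
| sym: "ceq s t \<Longrightarrow> ceq t s"
| trans: "ceq s t \<Longrightarrow> ceq t u \<Longrightarrow> ceq s u"
| comp: "ceq f f' \<Longrightarrow> ceq g g' \<Longrightarrow> ceq (Comp f g) (Comp f' g')"
| tens: "ceq f f' \<Longrightarrow> ceq g g' \<Longrightarrow> ceq (Tens f g) (Tens f' g')"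
| id_l: "tgt f = n \<Longrightarrow> ceq (Comp (Id n) f) f"
| id_r: "src f = m \<Longrightarrow> ceq (Comp f (Id m)) f"
| comp_assoc: "ceq (Comp (Comp f g) h) (Comp f (Comp g h))"
| tens_assoc: "ceq (Tens (Tens f g) h) (Tens f (Tens g h))"
| unit_l: "ceq (Tens (Id 0) f) f"
| unit_r: "ceq (Tens f (Id 0)) f"
| tens_id: "ceq (Tens (Id m) (Id n)) (Id (m + n))"
| interchange: "src f' = tgt f \<Longrightarrow> src g' = tgt g \<Longrightarrow>
    ceq (Comp (Tens f' g') (Tens f g)) (Tens (Comp f' f) (Comp g' g))"
| br_inv1: "ceq (Comp (Br m n) (BrInv m n)) (Id (n + m))"
| br_inv2: "ceq (Comp (BrInv m n) (Br m n)) (Id (m + n))"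
| br_nat: "ceq (Comp (Br (tgt f) (tgt g)) (Tens f g)) (Comp (Tens g f) (Br (src f) (src g)))"
| hex1: "ceq (Br l (m + n)) (Comp (Tens (Id m) (Br l n)) (Tens (Br l m) (Id n)))"
| hex2: "ceq (Br (l + m) n) (Comp (Tens (Br l n) (Id m)) (Tens (Id l) (Br m n)))"
| ax: "(s, t) \<in> coc_rel \<Longrightarrow> ceq s t"

lemma ceq_src_tgt: "ceq s t \<Longrightarrow> src s = src t \<and> tgt s = tgt t"
  by (induction rule: ceq.induct) (auto dest: coc_rel_wf)

lemma ideal_diff:
  assumes "(m, n, \<lambda>s. f s - g s) \<in> ideal V" "(m, n, \<lambda>s. g s - h s) \<in> ideal V"
  shows "(m, n, \<lambda>s. f s - h s) \<in> ideal V"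
  using ideal.id_add[OF assms] by (simp add: algebra_simps)

lemma ideal_uminus:
  assumes "(m, n, \<lambda>s. f s - g s) \<in> ideal V"
  shows "(m, n, \<lambda>s. g s - f s) \<in> ideal V"
  using ideal.id_smult[OF assms, of "-1"] by (simp add: algebra_simps)

lemma df_trans: "(m, n, df s t) \<in> ideal V \<Longrightarrow> (m, n, df t u) \<in> ideal V \<Longrightarrow> (m, n, df s u) \<in> ideal V"
  unfolding df_def by (rule ideal_diff)

lemma df_Comp_left: "postc h (df s t) = df (Comp h s) (Comp h t)"
  by (auto simp: postc_def df_def lc_def fun_eq_iff split: tm.splits)

lemma df_Comp_right: "prec (df s t) h = df (Comp s h) (Comp t h)"
  by (auto simp: prec_def df_def lc_def fun_eq_iff split: tm.splits)

lemma df_Tens_left: "tensl h (df s t) = df (Tens h s) (Tens h t)"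
  by (auto simp: tensl_def df_def lc_def fun_eq_iff split: tm.splits)

lemma df_Tens_right: "tensr (df s t) h = df (Tens s h) (Tens t h)"
  by (auto simp: tensr_def df_def lc_def fun_eq_iff split: tm.splits)

text \<open>A derivation of \<open>ceq\<close> could pass through ill-typed terms. Carrying the
  equivalence of well-formedness through the induction shows that one with a well-formed end stays
  inside well-formed terms, where every step is a relation or an ideal rule.\<close>

lemma ceq_imp_ideal:
  "ceq s t \<Longrightarrow> (wf_tm s \<longleftrightarrow> wf_tm t) \<and>
     (wf_tm s \<longrightarrow> (src s, tgt s, df s t :: tm \<Rightarrow> 'k::field) \<in> ideal V_CocHopf)"
proof (induction rule: ceq.induct)
  case (refl t)
  then show ?case by (simp add: df_def ideal.id_zero)
next
  case (sym s t)
  then show ?case using ceq_src_tgt[of s t] by (auto simp: df_def intro: ideal_uminus)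
next
  case (trans s t u)
  then show ?case using ceq_src_tgt[of s t] by (auto intro: df_trans)
next
  case (comp f f' g g')
  note st = ceq_src_tgt[OF comp.hyps(1)] ceq_src_tgt[OF comp.hyps(2)]
  have "(src g, tgt f, df (Comp f g) (Comp f' g') :: tm \<Rightarrow> 'k) \<in> ideal V_CocHopf"
    if "wf_tm f" "wf_tm g" "src f = tgt g"
  \<comment> \<open>The ideal is closed under composing with one fixed term at a time, so first
    \<open>g\<close> and then \<open>f\<close> is replaced.\<close>
  proof (rule df_trans)
    show "(src g, tgt f, df (Comp f g) (Comp f g') :: tm \<Rightarrow> 'k) \<in> ideal V_CocHopf"
      unfolding df_Comp_left[symmetric] using that comp.IH st
      by (intro ideal.id_postc[where n = "tgt g"]) (simp_all add: typed_iff)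
    show "(src g, tgt f, df (Comp f g') (Comp f' g') :: tm \<Rightarrow> 'k) \<in> ideal V_CocHopf"
      unfolding df_Comp_right[symmetric] using that comp.IH st
      by (intro ideal.id_prec[where m = "src f"]) (simp_all add: typed_iff)
  qed
  then show ?case using comp st by auto
next
  case (tens f f' g g')
  note st = ceq_src_tgt[OF tens.hyps(1)] ceq_src_tgt[OF tens.hyps(2)]
  have "(src f + src g, tgt f + tgt g, df (Tens f g) (Tens f' g') :: tm \<Rightarrow> 'k) \<in> ideal V_CocHopf"
    if "wf_tm f" "wf_tm g"
  proof (rule df_trans)
    show "(src f + src g, tgt f + tgt g, df (Tens f g) (Tens f g') :: tm \<Rightarrow> 'k) \<in> ideal V_CocHopf"
      unfolding df_Tens_left[symmetric] using that tens.IH st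
      by (intro ideal.id_tensl) (simp_all add: typed_iff)
    show "(src f + src g, tgt f + tgt g, df (Tens f g') (Tens f' g') :: tm \<Rightarrow> 'k) \<in> ideal V_CocHopf"
      unfolding df_Tens_right[symmetric] using that tens.IH st
      by (intro ideal.id_tensr) (simp_all add: typed_iff)
  qed
  then show ?case using tens st by auto
next
  case (ax s t)
  then show ?case using coc_rel_wf[OF ax]
    by (force simp: V_CocHopf_eq intro: ideal.id_gen)
qed (auto simp: df_def typed_iff intro!: ideal.id_eqv
    eq_id_l eq_id_r eq_comp_assoc eq_tens_assoc eq_unit_l eq_unit_r eq_tens_id eq_interchange
    eq_br_inv1 eq_br_inv2 eq_br_nat eq_hex1 eq_hex2)

\<comment> \<open>The quotient category as a type\<close>
quotient_type mor = tm / ceq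
  by (intro equivpI reflpI sympI transpI) (auto intro: ceq.refl ceq.sym ceq.trans)

lift_definition idn :: "nat \<Rightarrow> mor" is Id .
lift_definition br :: "nat \<Rightarrow> nat \<Rightarrow> mor" is Br .
lift_definition brinv :: "nat \<Rightarrow> nat \<Rightarrow> mor" is BrInv .
lift_definition gm :: mor is mu .
lift_definition gu :: mor is uu .
lift_definition gd :: mor is De .
lift_definition ge :: mor is ep .
lift_definition gs :: mor is SS .
lift_definition comp :: "mor \<Rightarrow> mor \<Rightarrow> mor" (infixr "\<odot>" 70) is Comp by (rule ceq.comp)
lift_definition tens :: "mor \<Rightarrow> mor \<Rightarrow> mor" (infixr "\<otimes>" 75) is Tens by (rule ceq.tens)
lift_definition dom :: "mor \<Rightarrow> nat" is src by (simp add: ceq_src_tgt)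
lift_definition cod :: "mor \<Rightarrow> nat" is tgt by (simp add: ceq_src_tgt)

lemma dom_cod [simp]:
  "dom (idn n) = n" "cod (idn n) = n" "dom (br m n) = m + n" "cod (br m n) = n + m"
  "dom (brinv m n) = n + m" "cod (brinv m n) = m + n"
  "dom gm = 2" "cod gm = 1" "dom gu = 0" "cod gu = 1" "dom gd = 1" "cod gd = 2"
  "dom ge = 1" "cod ge = 0" "dom gs = 1" "cod gs = 1"
  "dom (f \<odot> g) = dom g" "cod (f \<odot> g) = cod f"
  "dom (f \<otimes> g) = dom f + dom g" "cod (f \<otimes> g) = cod f + cod g"
  by (transfer, simp)+

lemma id_l [simp]: "cod f = n \<Longrightarrow> idn n \<odot> f = f"
  by transfer (rule ceq.id_l)
lemma id_r [simp]: "dom f = n \<Longrightarrow> f \<odot> idn n = f"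
  by transfer (rule ceq.id_r)
lemma comp_assoc [simp]: "(f \<odot> g) \<odot> h = f \<odot> g \<odot> h"
  by transfer (rule ceq.comp_assoc)
lemma tens_assoc [simp]: "(f \<otimes> g) \<otimes> h = f \<otimes> g \<otimes> h"
  by transfer (rule ceq.tens_assoc)
lemma unit_l [simp]: "idn 0 \<otimes> f = f"
  by transfer (rule ceq.unit_l)
lemma unit_r [simp]: "f \<otimes> idn 0 = f"
  by transfer (rule ceq.unit_r)
lemma tens_id: "idn m \<otimes> idn n = idn (m + n)"
  by transfer (rule ceq.tens_id)
lemma interchange:
  "dom f' = cod f \<Longrightarrow> dom g' = cod g \<Longrightarrow> (f' \<otimes> g') \<odot> (f \<otimes> g) = (f' \<odot> f) \<otimes> (g' \<odot> g)"
  by transfer (rule ceq.interchange)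
lemma brinv_br: "brinv m n \<odot> br m n = idn (m + n)"
  by transfer (rule ceq.br_inv2)
lemma br_nat: "br (cod f) (cod g) \<odot> (f \<otimes> g) = (g \<otimes> f) \<odot> br (dom f) (dom g)"
  by transfer (rule ceq.br_nat)
lemma br_add_right: "br l (m + n) = (idn m \<otimes> br l n) \<odot> (br l m \<otimes> idn n)"
  by transfer (rule ceq.hex1)
lemma br_add_left: "br (l + m) n = (br l n \<otimes> idn m) \<odot> (idn l \<otimes> br m n)"
  by transfer (rule ceq.hex2)

text \<open>Simplification brackets composites to the right, so an equation between composites of
  two factors must also be available in front of a tail \<open>h\<close>;
  \<open>comp_cong_left\<close> does this for any such equation.\<close>

lemma interchange_comp:
  "dom f' = cod f \<Longrightarrow> dom g' = cod g \<Longrightarrow>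
   (f' \<otimes> g') \<odot> (f \<otimes> g) \<odot> h = ((f' \<odot> f) \<otimes> (g' \<odot> g)) \<odot> h"
  by (simp only: interchange comp_assoc[symmetric])

lemma comp_cong_left: "f \<odot> g = f' \<odot> g' \<Longrightarrow> f \<odot> g \<odot> h = f' \<odot> g' \<odot> h"
  by (metis comp_assoc)

lemma hopf_axioms:
  "gd = br 1 1 \<odot> gd"
  "br 1 1 \<odot> br 1 1 = idn 2"
  "gm \<odot> (gm \<otimes> idn 1) = gm \<odot> (idn 1 \<otimes> gm)"
  "gm \<odot> (gu \<otimes> idn 1) = idn 1"
  "gm \<odot> (idn 1 \<otimes> gu) = idn 1"
  "(gd \<otimes> idn 1) \<odot> gd = (idn 1 \<otimes> gd) \<odot> gd"
  "(ge \<otimes> idn 1) \<odot> gd = idn 1"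
  "(idn 1 \<otimes> ge) \<odot> gd = idn 1"
  "ge \<odot> gu = idn 0"
  "ge \<odot> gm = ge \<otimes> ge"
  "gd \<odot> gu = gu \<otimes> gu"
  "gd \<odot> gm = (gm \<otimes> gm) \<odot> ((idn 1 \<otimes> br 1 1) \<otimes> idn 1) \<odot> (gd \<otimes> gd)"
  "gm \<odot> (gs \<otimes> idn 1) \<odot> gd = gu \<odot> ge"
  "gm \<odot> (idn 1 \<otimes> gs) \<odot> gd = gu \<odot> ge"
  by (transfer, rule ceq.ax, simp add: coc_rel_def)+

text \<open>The hexagon with two zero summands makes \<open>br n 0\<close> idempotent, and an
  idempotent with a left inverse is the identity.\<close>

lemma br_0_right [simp]: "br n 0 = idn n"
proof -
  have "br n 0 = br n 0 \<odot> br n 0"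
    using br_add_right[of n 0 0] by simp
  then have "brinv n 0 \<odot> br n 0 = brinv n 0 \<odot> br n 0 \<odot> br n 0"
    by simp
  then show ?thesis
    by (simp add: brinv_br comp_assoc[symmetric] del: comp_assoc)
qed

lemma br_0_left [simp]: "br 0 n = idn n"
proof -
  have "br 0 n = br 0 n \<odot> br 0 n"
    using br_add_left[of 0 0 n] by simp
  then have "brinv 0 n \<odot> br 0 n = brinv 0 n \<odot> br 0 n \<odot> br 0 n"
    by simp
  then show ?thesis
    by (simp add: brinv_br comp_assoc[symmetric] del: comp_assoc)
qed

lemma br_br_add_right:
  assumes "br b a \<odot> br a b = idn (a + b)" "br c a \<odot> br a c = idn (a + c)"
  shows "br (b + c) a \<odot> br a (b + c) = idn (a + (b + c))"
proof -
  have "br (b + c) a \<odot> br a (b + c)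
      = (br b a \<otimes> idn c) \<odot> ((idn b \<otimes> br c a) \<odot> (idn b \<otimes> br a c)) \<odot> (br a b \<otimes> idn c)"
    by (simp add: br_add_right[of a b c] br_add_left[of b c a])
  also have "(idn b \<otimes> br c a) \<odot> (idn b \<otimes> br a c) = idn (b + (a + c))"
    by (simp add: interchange assms tens_id)
  also have "(br b a \<otimes> idn c) \<odot> idn (b + (a + c)) \<odot> (br a b \<otimes> idn c) = idn (a + (b + c))"
    by (simp add: interchange assms tens_id add.assoc)
  finally show ?thesis .
qed

lemma br_br_add_left:
  assumes "br c a \<odot> br a c = idn (a + c)" "br c b \<odot> br b c = idn (b + c)"
  shows "br c (a + b) \<odot> br (a + b) c = idn (a + b + c)"
proof -
  have "br c (a + b) \<odot> br (a + b) c
      = (idn a \<otimes> br c b) \<odot> ((br c a \<otimes> idn b) \<odot> (br a c \<otimes> idn b)) \<odot> (idn a \<otimes> br b c)"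
    by (simp add: br_add_right[of c a b] br_add_left[of a b c])
  also have "(br c a \<otimes> idn b) \<odot> (br a c \<otimes> idn b) = idn (a + c + b)"
    by (simp add: interchange assms tens_id)
  also have "(idn a \<otimes> br c b) \<odot> idn (a + c + b) \<odot> (idn a \<otimes> br b c) = idn (a + b + c)"
    by (simp add: interchange assms tens_id add.assoc)
  finally show ?thesis .
qed

text \<open>The axioms give symmetry for two single wires. The hexagons extend it, first with one
  index fixed at 1, then in the other index.\<close>

lemma br_br [simp]: "br b a \<odot> br a b = idn (a + b)"
proof -
  have 1: "br 1 a \<odot> br a 1 = idn (a + 1)" for a
  proof (induction a)
    case (Suc a)
    then show ?case
      using br_br_add_left[of 1 a 1] hopf_axioms(2) by (simp add: numeral_2_eq_2)
  qed simp
  show ?thesis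
  proof (induction b)
    case (Suc b)
    then show ?case
      using br_br_add_right[of b a 1] 1[of a] by simp
  qed simp
qed


subsection \<open>Cocommutative comonoids\<close>

text \<open>The middle-four exchange, from the order \<open>a a b b\<close> to
  \<open>a b a b\<close>, as in the comultiplication of a tensor product.\<close>

definition mid :: "nat \<Rightarrow> nat \<Rightarrow> mor" where
  "mid a b = idn a \<otimes> br a b \<otimes> idn b"

lemma dom_cod_mid [simp]: "dom (mid a b) = a + a + b + b" "cod (mid a b) = a + b + a + b"
  by (simp_all add: mid_def)

text \<open>Naturality of the braiding for the two inner factors. The widths on either side are left
  free because the factors include comultiplications, units and counits, which change them.\<close>

lemma mid_nat:
  "(f \<otimes> g \<otimes> f' \<otimes> g') \<odot> (idn (dom f) \<otimes> br (dom f') (dom g) \<otimes> idn (dom g'))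
   = (idn (cod f) \<otimes> br (cod f') (cod g) \<otimes> idn (cod g')) \<odot> (f \<otimes> f' \<otimes> g \<otimes> g')"
proof -
  have "(f \<otimes> (g \<otimes> f') \<otimes> g') \<odot> (idn (dom f) \<otimes> br (dom f') (dom g) \<otimes> idn (dom g'))
      = f \<otimes> (br (cod f') (cod g) \<odot> (f' \<otimes> g)) \<otimes> g'"
    unfolding br_nat by (simp add: interchange del: tens_assoc)
  also have "\<dots> = (idn (cod f) \<otimes> br (cod f') (cod g) \<otimes> idn (cod g')) \<odot> (f \<otimes> (f' \<otimes> g) \<otimes> g')"
    by (simp add: interchange del: tens_assoc)
  finally show ?thesis by simp
qed

definition coc_comonoid :: "nat \<Rightarrow> mor \<Rightarrow> mor \<Rightarrow> bool" where
  "coc_comonoid a d e \<longleftrightarrow>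
     dom d = a \<and> cod d = a + a \<and> dom e = a \<and> cod e = 0 \<and>
     (d \<otimes> idn a) \<odot> d = (idn a \<otimes> d) \<odot> d \<and>
     (e \<otimes> idn a) \<odot> d = idn a \<and> (idn a \<otimes> e) \<odot> d = idn a \<and> br a a \<odot> d = d"

lemma coc_comonoidD:
  assumes "coc_comonoid a d e"
  shows "dom d = a" "cod d = a + a" "dom e = a" "cod e = 0"
    "(d \<otimes> idn a) \<odot> d = (idn a \<otimes> d) \<odot> d"
    "(e \<otimes> idn a) \<odot> d = idn a" "(idn a \<otimes> e) \<odot> d = idn a" "br a a \<odot> d = d"
  using assms by (simp_all add: coc_comonoid_def)

lemma coc_comonoid_0: "coc_comonoid 0 (idn 0) (idn 0)"
  by (simp add: coc_comonoid_def)

lemma coc_comonoid_1: "coc_comonoid 1 gd ge"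
  using hopf_axioms by (simp add: coc_comonoid_def)

lemma coc_comonoid_tens:
  assumes d: "coc_comonoid a d e" and d': "coc_comonoid b d' e'"
  shows "coc_comonoid (a + b) (mid a b \<odot> (d \<otimes> d')) (e \<otimes> e')"
proof -
  note [simp] = coc_comonoidD(1-4)[OF d] coc_comonoidD(1-4)[OF d']
  let ?D = "mid a b \<odot> (d \<otimes> d')"
  \<comment> \<open>Facts \<open>1\<close> and \<open>2\<close> bring both iterated
    comultiplications into the form of a rearrangement of wires after the tensor product of the two
    iterated ones. Coassociativity of the factors then leaves only the comparison of the
    rearrangements, fact \<open>3\<close>.\<close>
  have 1: "(?D \<otimes> idn (a + b)) \<odot> ?D
      = (mid a b \<otimes> idn a \<otimes> idn b) \<odot> (idn a \<otimes> idn a \<otimes> br a (b + b) \<otimes> idn b) \<odot>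
        (((d \<otimes> idn a) \<odot> d) \<otimes> ((d' \<otimes> idn b) \<odot> d'))"
  proof -
    have "(?D \<otimes> idn (a + b)) = (mid a b \<otimes> idn (a + b)) \<odot> ((d \<otimes> d') \<otimes> idn (a + b))"
      by (subst interchange) (simp_all add: add_ac)
    then have "(?D \<otimes> idn (a + b)) \<odot> ?D = (mid a b \<otimes> idn a \<otimes> idn b) \<odot>
        ((d \<otimes> d' \<otimes> idn a \<otimes> idn b) \<odot> (idn a \<otimes> br a b \<otimes> idn b)) \<odot> (d \<otimes> d')"
      by (simp add: tens_id mid_def)
    also have "(d \<otimes> d' \<otimes> idn a \<otimes> idn b) \<odot> (idn a \<otimes> br a b \<otimes> idn b)
        = (idn (a + a) \<otimes> br a (b + b) \<otimes> idn b) \<odot> (d \<otimes> idn a \<otimes> d' \<otimes> idn b)"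
      using mid_nat[of d d' "idn a" "idn b"] by simp
    also have "idn (a + a) \<otimes> br a (b + b) \<otimes> idn b = idn a \<otimes> idn a \<otimes> br a (b + b) \<otimes> idn b"
      by (simp add: tens_id[symmetric])
    also have "(mid a b \<otimes> idn a \<otimes> idn b) \<odot> ((idn a \<otimes> idn a \<otimes> br a (b + b) \<otimes> idn b) \<odot>
        (d \<otimes> idn a \<otimes> d' \<otimes> idn b)) \<odot> (d \<otimes> d') =
        (mid a b \<otimes> idn a \<otimes> idn b) \<odot> (idn a \<otimes> idn a \<otimes> br a (b + b) \<otimes> idn b) \<odot>
        (((d \<otimes> idn a) \<otimes> (d' \<otimes> idn b)) \<odot> (d \<otimes> d'))"
      by simp
    also have "((d \<otimes> idn a) \<otimes> (d' \<otimes> idn b)) \<odot> (d \<otimes> d') = ((d \<otimes> idn a) \<odot> d) \<otimes> ((d' \<otimes> idn b) \<odot> d')"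
      by (rule interchange) simp_all
    finally show ?thesis .
  qed
  have 2: "(idn (a + b) \<otimes> ?D) \<odot> ?D
      = (idn a \<otimes> idn b \<otimes> mid a b) \<odot> (idn a \<otimes> br (a + a) b \<otimes> idn b \<otimes> idn b) \<odot>
        (((idn a \<otimes> d) \<odot> d) \<otimes> ((idn b \<otimes> d') \<odot> d'))"
  proof -
    have "(idn (a + b) \<otimes> ?D) = (idn (a + b) \<otimes> mid a b) \<odot> (idn (a + b) \<otimes> (d \<otimes> d'))"
      by (subst interchange) (simp_all add: add_ac)
    then have "(idn (a + b) \<otimes> ?D) \<odot> ?D = (idn a \<otimes> idn b \<otimes> mid a b) \<odot>
        ((idn a \<otimes> idn b \<otimes> d \<otimes> d') \<odot> (idn a \<otimes> br a b \<otimes> idn b)) \<odot> (d \<otimes> d')"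
      by (simp add: tens_id[symmetric] mid_def)
    also have "(idn a \<otimes> idn b \<otimes> d \<otimes> d') \<odot> (idn a \<otimes> br a b \<otimes> idn b)
        = (idn a \<otimes> br (a + a) b \<otimes> idn (b + b)) \<odot> (idn a \<otimes> d \<otimes> idn b \<otimes> d')"
      using mid_nat[of "idn a" "idn b" d d'] by simp
    also have "idn a \<otimes> br (a + a) b \<otimes> idn (b + b) = idn a \<otimes> br (a + a) b \<otimes> idn b \<otimes> idn b"
      by (simp add: tens_id[symmetric])
    also have "(idn a \<otimes> idn b \<otimes> mid a b) \<odot> ((idn a \<otimes> br (a + a) b \<otimes> idn b \<otimes> idn b) \<odot>
        (idn a \<otimes> d \<otimes> idn b \<otimes> d')) \<odot> (d \<otimes> d') =
        (idn a \<otimes> idn b \<otimes> mid a b) \<odot> (idn a \<otimes> br (a + a) b \<otimes> idn b \<otimes> idn b) \<odot>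
        (((idn a \<otimes> d) \<otimes> (idn b \<otimes> d')) \<odot> (d \<otimes> d'))"
      by simp
    also have "((idn a \<otimes> d) \<otimes> (idn b \<otimes> d')) \<odot> (d \<otimes> d') = ((idn a \<otimes> d) \<odot> d) \<otimes> ((idn b \<otimes> d') \<odot> d')"
      by (rule interchange) simp_all
    finally show ?thesis .
  qed
  \<comment> \<open>Both sides take three copies of \<open>a\<close> followed by three of
    \<open>b\<close> to alternating order. The hexagons cut the wide braidings into crossings
    \<open>?t\<close>, and two crossings on disjoint wires commute.\<close>
  have 3: "(mid a b \<otimes> idn a \<otimes> idn b) \<odot> (idn a \<otimes> idn a \<otimes> br a (b + b) \<otimes> idn b)
         = (idn a \<otimes> idn b \<otimes> mid a b) \<odot> (idn a \<otimes> br (a + a) b \<otimes> idn b \<otimes> idn b)"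
  proof -
    let ?t = "br a b"
    have "(?t \<otimes> idn b \<otimes> idn a) \<odot> (idn a \<otimes> br a (b + b))
        = ((?t \<otimes> idn (b + a)) \<odot> (idn (a + b) \<otimes> ?t)) \<odot> (idn a \<otimes> ?t \<otimes> idn b)"
      by (simp add: br_add_right tens_id[symmetric] interchange)
    also have "(?t \<otimes> idn (b + a)) \<odot> (idn (a + b) \<otimes> ?t) = (idn (b + a) \<otimes> ?t) \<odot> (?t \<otimes> idn (a + b))"
      by (simp add: interchange)
    also have "\<dots> \<odot> (idn a \<otimes> ?t \<otimes> idn b) = (idn b \<otimes> idn a \<otimes> ?t) \<odot> (br (a + a) b \<otimes> idn b)"
    proof -
      have "br (a + a) b \<otimes> idn b = ((?t \<otimes> idn a) \<otimes> idn b) \<odot> ((idn a \<otimes> ?t) \<otimes> idn b)"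
        by (subst interchange) (simp_all add: br_add_left)
      then show ?thesis by (simp add: tens_id[symmetric])
    qed
    finally have *: "(?t \<otimes> idn b \<otimes> idn a) \<odot> (idn a \<otimes> br a (b + b))
        = (idn b \<otimes> idn a \<otimes> ?t) \<odot> (br (a + a) b \<otimes> idn b)" .
    have "(idn a \<otimes> (?t \<otimes> idn b \<otimes> idn a) \<otimes> idn b) \<odot> (idn a \<otimes> (idn a \<otimes> br a (b + b)) \<otimes> idn b)
        = (idn a \<otimes> (idn b \<otimes> idn a \<otimes> ?t) \<otimes> idn b) \<odot> (idn a \<otimes> (br (a + a) b \<otimes> idn b) \<otimes> idn b)"
      using * by (simp add: interchange del: tens_assoc)
    then show ?thesis by (simp add: mid_def)
  qed
  have coassoc: "(?D \<otimes> idn (a + b)) \<odot> ?D = (idn (a + b) \<otimes> ?D) \<odot> ?D"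
    unfolding 1 2 coc_comonoidD(5)[OF d] coc_comonoidD(5)[OF d']
    using comp_cong_left[OF 3] by simp
  have counit: "((e \<otimes> e') \<otimes> idn (a + b)) \<odot> ?D = idn (a + b)"
  proof -
    have "((e \<otimes> e') \<otimes> idn (a + b)) \<odot> ?D
        = ((e \<otimes> e' \<otimes> idn a \<otimes> idn b) \<odot> (idn a \<otimes> br a b \<otimes> idn b)) \<odot> (d \<otimes> d')"
      by (simp add: tens_id mid_def)
    also have "(e \<otimes> e' \<otimes> idn a \<otimes> idn b) \<odot> (idn a \<otimes> br a b \<otimes> idn b) = (e \<otimes> idn a) \<otimes> (e' \<otimes> idn b)"
      using mid_nat[of e e' "idn a" "idn b"] by (simp add: tens_id)
    also have "\<dots> \<odot> (d \<otimes> d') = idn (a + b)"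
      using coc_comonoidD(6)[OF d] coc_comonoidD(6)[OF d']
      by (subst interchange) (simp_all add: tens_id)
    finally show ?thesis .
  qed
  have counit': "(idn (a + b) \<otimes> (e \<otimes> e')) \<odot> ?D = idn (a + b)"
  proof -
    have "(idn (a + b) \<otimes> (e \<otimes> e')) \<odot> ?D
        = ((idn a \<otimes> idn b \<otimes> e \<otimes> e') \<odot> (idn a \<otimes> br a b \<otimes> idn b)) \<odot> (d \<otimes> d')"
      by (simp add: tens_id[symmetric] mid_def)
    also have "(idn a \<otimes> idn b \<otimes> e \<otimes> e') \<odot> (idn a \<otimes> br a b \<otimes> idn b) = (idn a \<otimes> e) \<otimes> (idn b \<otimes> e')"
      using mid_nat[of "idn a" "idn b" e e'] by (simp add: tens_id[symmetric])
        (simp add: tens_id interchange)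
    also have "\<dots> \<odot> (d \<otimes> d') = idn (a + b)"
      using coc_comonoidD(7)[OF d] coc_comonoidD(7)[OF d']
      by (subst interchange) (simp_all add: tens_id)
    finally show ?thesis .
  qed
  have cocomm: "br (a + b) (a + b) \<odot> ?D = ?D"
  proof -
    \<comment> \<open>The block swap splits so that its innermost crossing meets the
      \<open>mid a b\<close> of \<open>?D\<close> and cancels by symmetry; what remains is the swap
      of each factor, absorbed by \<open>d\<close> and \<open>d'\<close>.\<close>
    have "br (a + b) (a + b) = mid a b \<odot> (br a a \<otimes> br b b) \<odot> (idn a \<otimes> br b a \<otimes> idn b)"
    proof -
      have "br (a + b) (a + b)
          = (((idn a \<otimes> br a b) \<odot> (br a a \<otimes> idn b)) \<otimes> idn b) \<odot>
            (idn a \<otimes> ((idn a \<otimes> br b b) \<odot> (br b a \<otimes> idn b)))"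
        unfolding br_add_left[of a b "a + b"] br_add_right[of a a b] br_add_right[of b a b] ..
      also have "\<dots> = (((idn a \<otimes> br a b) \<otimes> idn b) \<odot> ((br a a \<otimes> idn b) \<otimes> idn b)) \<odot>
            ((idn a \<otimes> idn a \<otimes> br b b) \<odot> (idn a \<otimes> br b a \<otimes> idn b))"
        by (simp add: interchange del: tens_assoc)
      also have "\<dots> = mid a b \<odot> ((br a a \<otimes> idn (b + b)) \<odot> (idn (a + a) \<otimes> br b b)) \<odot>
            (idn a \<otimes> br b a \<otimes> idn b)"
        by (simp add: mid_def tens_id[symmetric])
      also have "(br a a \<otimes> idn (b + b)) \<odot> (idn (a + a) \<otimes> br b b) = br a a \<otimes> br b b"
        by (simp add: interchange)
      finally show ?thesis .
    qed
    then have "br (a + b) (a + b) \<odot> ?D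
        = mid a b \<odot> (br a a \<otimes> br b b) \<odot> ((idn a \<otimes> br b a \<otimes> idn b) \<odot> mid a b) \<odot> (d \<otimes> d')"
      by simp
    also have "(idn a \<otimes> br b a \<otimes> idn b) \<odot> mid a b = idn (a + a + b + b)"
      by (simp add: mid_def interchange tens_id add_ac)
    also have "mid a b \<odot> (br a a \<otimes> br b b) \<odot> idn (a + a + b + b) \<odot> (d \<otimes> d') = ?D"
      using coc_comonoidD(8)[OF d] coc_comonoidD(8)[OF d'] by (simp add: interchange add_ac)
    finally show ?thesis .
  qed
  show ?thesis
    unfolding coc_comonoid_def using coassoc counit counit' cocomm by (simp add: add_ac)
qed

text \<open>By coassociativity the two middle copies of the fourfold copy can be produced by a
  single \<open>d\<close>, which absorbs their exchange by cocommutativity. \<open>gd_gs\<close> and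
  \<open>gl_conv\<close> rest on this.\<close>

lemma coc_comonoid_four:
  assumes "coc_comonoid a d e"
  shows "mid a a \<odot> (d \<otimes> d) \<odot> d = (d \<otimes> d) \<odot> d"
proof -
  note [simp] = coc_comonoidD(1-4)[OF assms] and ax = coc_comonoidD(5-8)[OF assms]
  have "(d \<otimes> d) = (d \<otimes> idn (a + a)) \<odot> (idn a \<otimes> d)"
    by (simp add: interchange)
  then have "(d \<otimes> d) \<odot> d = (d \<otimes> idn (a + a)) \<odot> ((idn a \<otimes> d) \<odot> d)"
    by simp
  also have "\<dots> = ((d \<otimes> idn a) \<otimes> idn a) \<odot> (d \<otimes> idn a) \<odot> d"
    by (simp add: ax tens_id)
  also have "\<dots> = (((d \<otimes> idn a) \<odot> d) \<otimes> idn a) \<odot> d"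
    by (simp add: interchange interchange_comp del: tens_assoc)
  also have "\<dots> = (((idn a \<otimes> d) \<odot> d) \<otimes> idn a) \<odot> d"
    by (simp only: ax)
  also have "\<dots> = ((idn a \<otimes> d) \<otimes> idn a) \<odot> (d \<otimes> idn a) \<odot> d"
    by (simp add: interchange interchange_comp del: tens_assoc)
  finally have *: "(d \<otimes> d) \<odot> d = ((idn a \<otimes> d) \<otimes> idn a) \<odot> (d \<otimes> idn a) \<odot> d" .
  have "mid a a \<odot> ((idn a \<otimes> d) \<otimes> idn a) = (idn a \<otimes> d) \<otimes> idn a"
    unfolding mid_def tens_assoc by (simp add: interchange ax)
  then show ?thesis
    unfolding * using comp_cong_left by (metis comp_assoc)
qed


subsection \<open>Convolution\<close>

text \<open>Convolution with multiplication and comultiplication left as parameters: it is used with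
  \<open>gm\<close> and \<open>D k\<close>, and in \<open>gd_gs\<close> with the multiplication of
  the tensor square.\<close>

definition cv :: "mor \<Rightarrow> mor \<Rightarrow> mor \<Rightarrow> mor \<Rightarrow> mor" where
  "cv M d f g = M \<odot> (f \<otimes> g) \<odot> d"

lemma cv_assoc:
  assumes M: "M \<odot> (M \<otimes> idn c) = M \<odot> (idn c \<otimes> M)" "dom M = c + c" "cod M = c"
    and d: "(d \<otimes> idn a) \<odot> d = (idn a \<otimes> d) \<odot> d" "dom d = a" "cod d = a + a"
    and f: "dom f = a" "cod f = c" and g: "dom g = a" "cod g = c" and h: "dom h = a" "cod h = c"
  shows "cv M d (cv M d f g) h = cv M d f (cv M d g h)"
proof -
  note [simp] = assms(2,3,5-)
  have "cv M d (cv M d f g) h = M \<odot> ((M \<otimes> idn c) \<odot> ((f \<otimes> g) \<otimes> h) \<odot> (d \<otimes> idn a)) \<odot> d"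
    unfolding cv_def by (simp add: interchange del: tens_assoc)
  also have "\<dots> = (M \<odot> (M \<otimes> idn c)) \<odot> (f \<otimes> g \<otimes> h) \<odot> ((d \<otimes> idn a) \<odot> d)"
    by simp
  also have "\<dots> = M \<odot> ((idn c \<otimes> M) \<odot> (f \<otimes> (g \<otimes> h)) \<odot> (idn a \<otimes> d)) \<odot> d"
    by (simp only: M(1) d(1) comp_assoc)
  also have "\<dots> = cv M d f (cv M d g h)"
    unfolding cv_def by (simp add: interchange del: tens_assoc)
  finally show ?thesis .
qed

lemma cv_unit_left:
  assumes "M \<odot> (u \<otimes> idn c) = idn c" "(e \<otimes> idn a) \<odot> d = idn a"
    and "dom u = 0" "cod e = 0" "cod u = c" "dom e = a" "dom g = a" "cod g = c"
  shows "cv M d (u \<odot> e) g = g"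
proof -
  have "(u \<odot> e) \<otimes> g = (u \<otimes> idn c) \<odot> (idn 0 \<otimes> g) \<odot> (e \<otimes> idn a)"
    using assms(3-) by (simp only: interchange dom_cod id_l id_r comp_assoc)
  then have "cv M d (u \<odot> e) g = (M \<odot> (u \<otimes> idn c)) \<odot> g \<odot> ((e \<otimes> idn a) \<odot> d)"
    by (simp add: cv_def)
  with assms show ?thesis by simp
qed

lemma cv_unit_right:
  assumes "M \<odot> (idn c \<otimes> u) = idn c" "(idn a \<otimes> e) \<odot> d = idn a"
    and "dom u = 0" "cod e = 0" "cod u = c" "dom e = a" "dom g = a" "cod g = c"
  shows "cv M d g (u \<odot> e) = g"
proof -
  have "g \<otimes> (u \<odot> e) = (idn c \<otimes> u) \<odot> (g \<otimes> idn 0) \<odot> (idn a \<otimes> e)"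
    using assms(3-) by (simp only: interchange dom_cod id_l id_r comp_assoc)
  then have "cv M d g (u \<odot> e) = (M \<odot> (idn c \<otimes> u)) \<odot> g \<odot> ((idn a \<otimes> e) \<odot> d)"
    by (simp add: cv_def)
  with assms show ?thesis by simp
qed


subsection \<open>The antipode is a coalgebra map\<close>

text \<open>Apply \<open>ge\<close> to the antipode law: one side collapses to
  \<open>ge \<odot> gs\<close> by a counit law, the other to \<open>ge\<close>.\<close>

lemma ge_gs: "ge \<odot> gs = ge"
proof -
  have "ge = ge \<odot> gu \<odot> ge"
    using hopf_axioms(9) by (simp add: comp_assoc[symmetric] del: comp_assoc)
  also have "\<dots> = (ge \<odot> gm) \<odot> (gs \<otimes> idn 1) \<odot> gd"
    by (simp only: hopf_axioms(13)[symmetric] comp_assoc)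
  also have "\<dots> = ((ge \<odot> gs) \<otimes> ge) \<odot> gd"
    by (simp only: hopf_axioms(10) interchange_comp dom_cod) simp
  also have "(ge \<odot> gs) \<otimes> ge = (ge \<odot> gs) \<odot> (idn 1 \<otimes> ge)"
    using interchange[of "ge \<odot> gs" "idn 1" "idn 0" ge] by simp
  finally show ?thesis
    using hopf_axioms(8) by simp
qed

text \<open>Uniqueness of inverses for convolution of maps from 1 to 2, the target carrying the
  multiplication \<open>?M\<close> of the tensor square: \<open>?X\<close> is a left inverse of
  \<open>gd\<close> because \<open>gd\<close> is multiplicative, and \<open>?Y\<close> is a right
  inverse because the exchange in \<open>?M\<close> is absorbed by the fourfold copy.\<close>

lemma gd_gs: "gd \<odot> gs = (gs \<otimes> gs) \<odot> gd"
proof -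
  let ?M = "(gm \<otimes> gm) \<odot> mid 1 1"
  let ?X = "gd \<odot> gs" and ?Y = "(gs \<otimes> gs) \<odot> gd"
  have idn2: "idn 2 = idn 1 \<otimes> idn 1"
    by (simp add: tens_id numeral_2_eq_2)
  \<comment> \<open>Either bracketing sorts six factors into two triples by the same permutation;
    \<open>perm\<close> states this, and associativity of \<open>gm\<close> is then applied in each
    triple.\<close>
  have M_assoc: "?M \<odot> (?M \<otimes> idn 2) = ?M \<odot> (idn 2 \<otimes> ?M)"
  proof -
    let ?t = "br 1 1"
    have "(idn 1 \<otimes> br 2 1) \<odot> (?t \<otimes> idn 2)
        = (idn 1 \<otimes> ?t \<otimes> idn 1) \<odot> ((idn 2 \<otimes> ?t) \<odot> (?t \<otimes> idn 2))"
    proof -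
      have "idn 1 \<otimes> br 2 1 = (idn 1 \<otimes> (?t \<otimes> idn 1)) \<odot> (idn 1 \<otimes> (idn 1 \<otimes> ?t))"
        using br_add_left[of 1 1 1] by (subst interchange) (simp_all add: numeral_2_eq_2)
      then show ?thesis by (simp only: idn2 tens_assoc comp_assoc)
    qed
    also have "(idn 2 \<otimes> ?t) \<odot> (?t \<otimes> idn 2) = (?t \<otimes> idn 2) \<odot> (idn 2 \<otimes> ?t)"
      by (simp add: interchange)
    also have "(idn 1 \<otimes> ?t \<otimes> idn 1) \<odot> (?t \<otimes> idn 2) \<odot> (idn 2 \<otimes> ?t) = (br 1 2 \<otimes> idn 1) \<odot> (idn 2 \<otimes> ?t)"
    proof -
      have "br 1 2 \<otimes> idn 1 = ((idn 1 \<otimes> ?t) \<otimes> idn 1) \<odot> ((?t \<otimes> idn 1) \<otimes> idn 1)"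
        using br_add_right[of 1 1 1] by (subst interchange) (simp_all add: numeral_2_eq_2)
      then show ?thesis by (simp add: idn2)
    qed
    finally have *: "(idn 1 \<otimes> br 2 1) \<odot> (?t \<otimes> idn 2) = (br 1 2 \<otimes> idn 1) \<odot> (idn 2 \<otimes> ?t)" .
    have "(idn 1 \<otimes> (idn 1 \<otimes> br 2 1) \<otimes> idn 1) \<odot> (idn 1 \<otimes> (?t \<otimes> idn 2) \<otimes> idn 1)
        = (idn 1 \<otimes> (br 1 2 \<otimes> idn 1) \<otimes> idn 1) \<odot> (idn 1 \<otimes> (idn 2 \<otimes> ?t) \<otimes> idn 1)"
      using * by (simp add: interchange del: tens_assoc One_nat_def)
    then have perm: "(idn 2 \<otimes> br 2 1 \<otimes> idn 1) \<odot> (mid 1 1 \<otimes> idn 2)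
        = (idn 1 \<otimes> br 1 2 \<otimes> idn 2) \<odot> (idn 2 \<otimes> mid 1 1)"
      by (simp only: mid_def idn2 tens_assoc)
    have "?M \<otimes> idn 2 = ((gm \<otimes> gm) \<otimes> idn 2) \<odot> (mid 1 1 \<otimes> idn 2)"
      by (subst interchange) simp_all
    then have "?M \<odot> (?M \<otimes> idn 2)
        = (gm \<otimes> gm) \<odot> (mid 1 1 \<odot> (gm \<otimes> gm \<otimes> idn 1 \<otimes> idn 1)) \<odot> (mid 1 1 \<otimes> idn 2)"
      by (simp only: idn2 tens_assoc comp_assoc)
    also have "mid 1 1 \<odot> (gm \<otimes> gm \<otimes> idn 1 \<otimes> idn 1)
        = ((gm \<otimes> idn 1) \<otimes> (gm \<otimes> idn 1)) \<odot> (idn 2 \<otimes> br 2 1 \<otimes> idn 1)"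
      using mid_nat[of gm "idn 1" gm "idn 1"] by (simp add: mid_def)
    also have "(gm \<otimes> gm) \<odot> (((gm \<otimes> idn 1) \<otimes> (gm \<otimes> idn 1)) \<odot> (idn 2 \<otimes> br 2 1 \<otimes> idn 1)) \<odot> (mid 1 1 \<otimes> idn 2)
        = ((gm \<odot> (gm \<otimes> idn 1)) \<otimes> (gm \<odot> (gm \<otimes> idn 1))) \<odot> ((idn 2 \<otimes> br 2 1 \<otimes> idn 1) \<odot> (mid 1 1 \<otimes> idn 2))"
      by (simp add: interchange_comp del: tens_assoc)
    also have "\<dots> = (gm \<otimes> gm) \<odot> (((idn 1 \<otimes> gm) \<otimes> (idn 1 \<otimes> gm)) \<odot> (idn 1 \<otimes> br 1 2 \<otimes> idn 2)) \<odot> (idn 2 \<otimes> mid 1 1)"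
      unfolding perm hopf_axioms(3) by (simp add: interchange_comp del: tens_assoc)
    also have "((idn 1 \<otimes> gm) \<otimes> (idn 1 \<otimes> gm)) \<odot> (idn 1 \<otimes> br 1 2 \<otimes> idn 2)
        = mid 1 1 \<odot> (idn 1 \<otimes> idn 1 \<otimes> gm \<otimes> gm)"
      using mid_nat[of "idn 1" gm "idn 1" gm] by (simp add: mid_def)
    also have "(gm \<otimes> gm) \<odot> (mid 1 1 \<odot> (idn 1 \<otimes> idn 1 \<otimes> gm \<otimes> gm)) \<odot> (idn 2 \<otimes> mid 1 1)
        = ?M \<odot> ((idn 2 \<otimes> (gm \<otimes> gm)) \<odot> (idn 2 \<otimes> mid 1 1))"
      by (simp only: idn2 tens_assoc comp_assoc)
    also have "(idn 2 \<otimes> (gm \<otimes> gm)) \<odot> (idn 2 \<otimes> mid 1 1) = idn 2 \<otimes> ?M"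
      by (subst interchange) simp_all
    finally show ?thesis .
  qed
  have M_unit_l: "?M \<odot> ((gu \<otimes> gu) \<otimes> idn 2) = idn 2"
  proof -
    have "?M \<odot> ((gu \<otimes> gu) \<otimes> idn 2) = (gm \<otimes> gm) \<odot> (mid 1 1 \<odot> (gu \<otimes> gu \<otimes> idn 1 \<otimes> idn 1))"
      by (simp add: tens_id numeral_2_eq_2)
    also have "mid 1 1 \<odot> (gu \<otimes> gu \<otimes> idn 1 \<otimes> idn 1) = (gu \<otimes> idn 1) \<otimes> (gu \<otimes> idn 1)"
      using mid_nat[of gu "idn 1" gu "idn 1"] by (simp add: mid_def tens_id)
    also have "(gm \<otimes> gm) \<odot> \<dots> = idn 2"
      using hopf_axioms(4) by (subst interchange) (simp_all add: tens_id numeral_2_eq_2)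
    finally show ?thesis .
  qed
  have M_unit_r: "?M \<odot> (idn 2 \<otimes> (gu \<otimes> gu)) = idn 2"
  proof -
    have "?M \<odot> (idn 2 \<otimes> (gu \<otimes> gu)) = (gm \<otimes> gm) \<odot> (mid 1 1 \<odot> (idn 1 \<otimes> idn 1 \<otimes> gu \<otimes> gu))"
      by (simp only: idn2 tens_assoc comp_assoc)
    also have "mid 1 1 \<odot> (idn 1 \<otimes> idn 1 \<otimes> gu \<otimes> gu) = (idn 1 \<otimes> gu) \<otimes> (idn 1 \<otimes> gu)"
      using mid_nat[of "idn 1" gu "idn 1" gu] by (simp add: mid_def tens_id)
    also have "(gm \<otimes> gm) \<odot> \<dots> = idn 2"
      using hopf_axioms(5) by (subst interchange) (simp_all add: tens_id numeral_2_eq_2)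
    finally show ?thesis .
  qed
  have gd_gm: "gd \<odot> gm = ?M \<odot> (gd \<otimes> gd)"
    using hopf_axioms(12) by (simp add: mid_def)
  have XZ: "cv ?M gd ?X gd = (gu \<otimes> gu) \<odot> ge"
  proof -
    have "cv ?M gd ?X gd = (?M \<odot> (gd \<otimes> gd)) \<odot> (gs \<otimes> idn 1) \<odot> gd"
      by (simp add: cv_def interchange_comp)
    also have "\<dots> = gd \<odot> gm \<odot> (gs \<otimes> idn 1) \<odot> gd"
      by (simp only: comp_cong_left[OF gd_gm] comp_assoc)
    also have "\<dots> = (gd \<odot> gu) \<odot> ge"
      by (simp only: hopf_axioms(13) comp_assoc)
    finally show ?thesis
      by (simp only: hopf_axioms(11))
  qed
  have ZY: "cv ?M gd gd ?Y = (gu \<otimes> gu) \<odot> ge"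
  proof -
    have "gd \<otimes> ?Y = (idn 2 \<otimes> gs \<otimes> gs) \<odot> (gd \<otimes> gd)"
      by (subst interchange) simp_all
    then have "cv ?M gd gd ?Y
        = (gm \<otimes> gm) \<odot> (mid 1 1 \<odot> (idn 1 \<otimes> idn 1 \<otimes> gs \<otimes> gs)) \<odot> (gd \<otimes> gd) \<odot> gd"
      by (simp only: cv_def idn2 tens_assoc comp_assoc)
    also have "mid 1 1 \<odot> (idn 1 \<otimes> idn 1 \<otimes> gs \<otimes> gs) = ((idn 1 \<otimes> gs) \<otimes> (idn 1 \<otimes> gs)) \<odot> mid 1 1"
      using mid_nat[of "idn 1" gs "idn 1" gs] by (simp add: mid_def)
    also have "(gm \<otimes> gm) \<odot> (((idn 1 \<otimes> gs) \<otimes> (idn 1 \<otimes> gs)) \<odot> mid 1 1) \<odot> (gd \<otimes> gd) \<odot> gd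
        = (gm \<otimes> gm) \<odot> ((idn 1 \<otimes> gs) \<otimes> (idn 1 \<otimes> gs)) \<odot> (mid 1 1 \<odot> (gd \<otimes> gd) \<odot> gd)"
      by simp
    also have "mid 1 1 \<odot> (gd \<otimes> gd) \<odot> gd = (gd \<otimes> gd) \<odot> gd"
      by (rule coc_comonoid_four[OF coc_comonoid_1])
    also have "(gm \<otimes> gm) \<odot> ((idn 1 \<otimes> gs) \<otimes> (idn 1 \<otimes> gs)) \<odot> (gd \<otimes> gd) \<odot> gd
        = ((gm \<odot> (idn 1 \<otimes> gs) \<odot> gd) \<otimes> (gm \<odot> (idn 1 \<otimes> gs) \<odot> gd)) \<odot> gd"
      by (simp add: interchange_comp del: tens_assoc)
    also have "\<dots> = (gu \<otimes> gu) \<odot> (ge \<otimes> ge) \<odot> gd"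
      by (simp add: hopf_axioms(14)[unfolded One_nat_def] interchange_comp)
    also have "ge \<otimes> ge = ge \<odot> (ge \<otimes> idn 1)"
      using interchange[of "idn 0" ge ge "idn 1"] by simp
    also have "(gu \<otimes> gu) \<odot> (ge \<odot> (ge \<otimes> idn 1)) \<odot> gd = (gu \<otimes> gu) \<odot> ge"
      using hopf_axioms(7) by simp
    finally show ?thesis .
  qed
  have "cv ?M gd ?X ((gu \<otimes> gu) \<odot> ge) = ?X"
    by (rule cv_unit_right[where c = 2 and a = 1], rule M_unit_r, rule hopf_axioms(8)) simp_all
  then have "?X = cv ?M gd ?X (cv ?M gd gd ?Y)"
    by (simp only: ZY)
  also have "\<dots> = cv ?M gd (cv ?M gd ?X gd) ?Y"
    by (rule cv_assoc[where c = 2 and a = 1, symmetric], rule M_assoc) (use hopf_axioms(6) in simp_all)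
  also have "\<dots> = ?Y"
    unfolding XZ by (rule cv_unit_left[where c = 2 and a = 1], rule M_unit_l, rule hopf_axioms(7)) simp_all
  finally show ?thesis .
qed


subsection \<open>Finite products\<close>

text \<open>The comonoid structure of the \<open>k\<close>-fold tensor power: \<open>D k\<close>
  copies the block of \<open>k\<close> wires as a whole and \<open>E k\<close> discards it.\<close>

fun D :: "nat \<Rightarrow> mor" where
  "D 0 = idn 0"
| "D (Suc k) = mid 1 k \<odot> (gd \<otimes> D k)"

fun E :: "nat \<Rightarrow> mor" where
  "E 0 = idn 0"
| "E (Suc k) = ge \<otimes> E k"

lemma coc_comonoid_D: "coc_comonoid k (D k) (E k)"
proof (induction k)
  case (Suc k)
  then show ?case using coc_comonoid_tens[OF coc_comonoid_1 Suc] by simp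
qed (simp add: coc_comonoid_0)

lemmas dom_cod_D [simp] = coc_comonoid_D[THEN coc_comonoidD(1)] coc_comonoid_D[THEN coc_comonoidD(2)]
  coc_comonoid_D[THEN coc_comonoidD(3)] coc_comonoid_D[THEN coc_comonoidD(4)]
lemmas D_coassoc = coc_comonoid_D[THEN coc_comonoidD(5)]
lemmas D_counit_left = coc_comonoid_D[THEN coc_comonoidD(6)]
lemmas D_counit_right = coc_comonoid_D[THEN coc_comonoidD(7)]
lemmas D_cocomm = coc_comonoid_D[THEN coc_comonoidD(8)]

text \<open>Separates the first wire from the remaining \<open>k\<close>, so that inductions on the
  number of wires reduce to \<open>gd\<close> and \<open>D k\<close>.\<close>

lemma tens_D_Suc:
  assumes "dom f = 1" "dom f' = 1" "dom g = k" "dom g' = k"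
  shows "(f \<otimes> g \<otimes> f' \<otimes> g') \<odot> D (Suc k)
       = (idn (cod f) \<otimes> br (cod f') (cod g) \<otimes> idn (cod g')) \<odot>
         (((f \<otimes> f') \<odot> gd) \<otimes> ((g \<otimes> g') \<odot> D k))"
proof -
  have "(f \<otimes> g \<otimes> f' \<otimes> g') \<odot> D (Suc k)
      = ((f \<otimes> g \<otimes> f' \<otimes> g') \<odot> (idn 1 \<otimes> br 1 k \<otimes> idn k)) \<odot> (gd \<otimes> D k)"
    by (simp add: mid_def)
  also have "(f \<otimes> g \<otimes> f' \<otimes> g') \<odot> (idn 1 \<otimes> br 1 k \<otimes> idn k)
      = (idn (cod f) \<otimes> br (cod f') (cod g) \<otimes> idn (cod g')) \<odot> ((f \<otimes> f') \<otimes> (g \<otimes> g'))"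
    using mid_nat[of f g f' g'] assms by simp
  finally show ?thesis
    using assms by (simp add: interchange del: tens_assoc)
qed

text \<open>Group-like: for such f, S o f is a convolution inverse of f.\<close>

definition gl :: "nat \<Rightarrow> mor \<Rightarrow> bool" where
  "gl k f \<longleftrightarrow> dom f = k \<and> cod f = 1 \<and> gd \<odot> f = (f \<otimes> f) \<odot> D k \<and> ge \<odot> f = E k"

abbreviation conv :: "nat \<Rightarrow> mor \<Rightarrow> mor \<Rightarrow> mor" where
  "conv k \<equiv> cv gm (D k)"

definition one :: "nat \<Rightarrow> mor" where
  "one k = gu \<odot> E k"

lemma glD:
  assumes "gl k f"
  shows "dom f = k" "cod f = 1" "gd \<odot> f = (f \<otimes> f) \<odot> D k" "ge \<odot> f = E k"
  using assms by (simp_all add: gl_def)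

lemma conv_assoc:
  "gl k f \<Longrightarrow> gl k g \<Longrightarrow> gl k h \<Longrightarrow> conv k (conv k f g) h = conv k f (conv k g h)"
  using hopf_axioms(3) by (intro cv_assoc[where c = 1 and a = k]) (simp_all add: D_coassoc glD)

lemma conv_one_left: "gl k g \<Longrightarrow> conv k (one k) g = g"
  unfolding one_def using hopf_axioms(4)
  by (intro cv_unit_left[where c = 1 and a = k]) (simp_all add: D_counit_left glD)

lemma conv_one_right: "gl k g \<Longrightarrow> conv k g (one k) = g"
  unfolding one_def using hopf_axioms(5)
  by (intro cv_unit_right[where c = 1 and a = k]) (simp_all add: D_counit_right glD)

lemma E_E_D: "(E k \<otimes> E k) \<odot> D k = E k"
proof -
  have "E k \<otimes> E k = E k \<odot> (E k \<otimes> idn k)"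
    using interchange[of "idn 0" "E k" "E k" "idn k"] by simp
  then show ?thesis by (simp add: D_counit_left)
qed

lemma ge_ge_gd: "(ge \<otimes> ge) \<odot> gd = ge"
  using E_E_D[of 1] by (simp add: mid_def tens_id)

lemma gl_one: "gl k (one k)"
proof -
  have "gd \<odot> one k = (gd \<odot> gu) \<odot> E k"
    by (simp add: one_def)
  also have "\<dots> = (gu \<otimes> gu) \<odot> (E k \<otimes> E k) \<odot> D k"
    by (simp add: hopf_axioms(11) E_E_D)
  also have "\<dots> = (one k \<otimes> one k) \<odot> D k"
    by (simp add: one_def interchange_comp)
  finally show ?thesis
    using hopf_axioms(9) comp_assoc[of ge gu "E k"] by (simp add: gl_def one_def)
qed

text \<open>The bialgebra axiom moves \<open>gd\<close> past \<open>gm\<close> at the cost of a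
  middle exchange, which naturality carries to the fourfold copy, where it disappears.\<close>

lemma gl_conv:
  assumes f: "gl k f" and g: "gl k g"
  shows "gl k (conv k f g)"
proof -
  note [simp] = glD(1,2)[OF f] glD(1,2)[OF g]
  have "gd \<odot> conv k f g
      = (gm \<otimes> gm) \<odot> mid 1 1 \<odot> ((gd \<otimes> gd) \<odot> (f \<otimes> g)) \<odot> D k"
    using hopf_axioms(12) comp_cong_left[of gd gm]
    by (simp add: cv_def mid_def)
  also have "(gd \<otimes> gd) \<odot> (f \<otimes> g) = ((f \<otimes> f) \<otimes> (g \<otimes> g)) \<odot> (D k \<otimes> D k)"
    by (simp add: interchange glD(3)[OF f] glD(3)[OF g] del: tens_assoc)
  also have "(gm \<otimes> gm) \<odot> mid 1 1 \<odot> (((f \<otimes> f) \<otimes> (g \<otimes> g)) \<odot> (D k \<otimes> D k)) \<odot> D k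
      = (gm \<otimes> gm) \<odot> (mid 1 1 \<odot> (f \<otimes> f \<otimes> g \<otimes> g)) \<odot> (D k \<otimes> D k) \<odot> D k"
    by simp
  also have "mid 1 1 \<odot> (f \<otimes> f \<otimes> g \<otimes> g) = ((f \<otimes> g) \<otimes> (f \<otimes> g)) \<odot> mid k k"
    using mid_nat[of f g f g] by (simp add: mid_def)
  also have "(gm \<otimes> gm) \<odot> (((f \<otimes> g) \<otimes> (f \<otimes> g)) \<odot> mid k k) \<odot> (D k \<otimes> D k) \<odot> D k
      = (gm \<otimes> gm) \<odot> ((f \<otimes> g) \<otimes> (f \<otimes> g)) \<odot> (mid k k \<odot> (D k \<otimes> D k) \<odot> D k)"
    by simp
  also have "mid k k \<odot> (D k \<otimes> D k) \<odot> D k = (D k \<otimes> D k) \<odot> D k"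
    by (rule coc_comonoid_four[OF coc_comonoid_D])
  also have "(gm \<otimes> gm) \<odot> ((f \<otimes> g) \<otimes> (f \<otimes> g)) \<odot> (D k \<otimes> D k) \<odot> D k
      = (conv k f g \<otimes> conv k f g) \<odot> D k"
    by (simp add: cv_def interchange_comp del: tens_assoc)
  finally have 1: "gd \<odot> conv k f g = (conv k f g \<otimes> conv k f g) \<odot> D k" .
  have "ge \<odot> conv k f g = (ge \<otimes> ge) \<odot> (f \<otimes> g) \<odot> D k"
    using hopf_axioms(10) comp_cong_left[of ge gm "ge \<otimes> ge" "idn 2"] by (simp add: cv_def)
  also have "\<dots> = E k"
    by (simp add: interchange_comp glD(4)[OF f] glD(4)[OF g] E_E_D)
  finally show ?thesis
    using 1 by (simp add: gl_def cv_def)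
qed

lemma gl_gs:
  assumes f: "gl k f"
  shows "gl k (gs \<odot> f)"
proof -
  note [simp] = glD(1,2)[OF f]
  have "gd \<odot> gs \<odot> f = (gs \<otimes> gs) \<odot> (gd \<odot> f)"
    using comp_cong_left[OF gd_gs] by simp
  also have "\<dots> = ((gs \<odot> f) \<otimes> (gs \<odot> f)) \<odot> D k"
    by (simp add: glD(3)[OF f] interchange_comp)
  finally show ?thesis
    using glD(4)[OF f] ge_gs comp_assoc[of ge gs f] by (simp add: gl_def)
qed

text \<open>Group-likeness turns the two copies of \<open>f\<close> after \<open>D k\<close> into
  \<open>gd\<close> after \<open>f\<close>, so the antipode law applies in front of
  \<open>f\<close>.\<close>

lemma conv_gs_left:
  assumes f: "gl k f"
  shows "conv k (gs \<odot> f) f = one k"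
proof -
  note [simp] = glD(1,2)[OF f]
  have "conv k (gs \<odot> f) f = gm \<odot> (gs \<otimes> idn 1) \<odot> ((f \<otimes> f) \<odot> D k)"
    by (simp add: cv_def interchange_comp)
  also have "\<dots> = (gm \<odot> (gs \<otimes> idn 1) \<odot> gd) \<odot> f"
    by (simp only: glD(3)[OF f, symmetric] comp_assoc)
  also have "\<dots> = one k"
    by (simp only: hopf_axioms(13) comp_assoc glD(4)[OF f] one_def)
  finally show ?thesis .
qed

lemma conv_gs_right:
  assumes f: "gl k f"
  shows "conv k f (gs \<odot> f) = one k"
proof -
  note [simp] = glD(1,2)[OF f]
  have "conv k f (gs \<odot> f) = gm \<odot> (idn 1 \<otimes> gs) \<odot> ((f \<otimes> f) \<odot> D k)"
    by (simp add: cv_def interchange_comp)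
  also have "\<dots> = (gm \<odot> (idn 1 \<otimes> gs) \<odot> gd) \<odot> f"
    by (simp only: glD(3)[OF f, symmetric] comp_assoc)
  also have "\<dots> = one k"
    by (simp only: hopf_axioms(14) comp_assoc glD(4)[OF f] one_def)
  finally show ?thesis .
qed

section \<open>The convolution group generated by the projections\<close>

fun proj :: "nat \<Rightarrow> nat \<Rightarrow> mor" where
  "proj 0 j = gu"
| "proj (Suc k) j = (if j = 1 then idn 1 \<otimes> E k else ge \<otimes> proj k (j - 1))"

text \<open>Indices count from 1. Any other index runs down to \<open>proj 0 j = gu\<close>, which
  discards every input and is still group-like, so \<open>word_mor\<close> is group-like on every
  word.\<close>

lemma gl_proj: "gl k (proj k j)"
proof (induction k arbitrary: j)
  case 0
  show ?case using gl_one[of 0] by (simp add: one_def)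
next
  case (Suc k)
  define i where "i = j - 1"
  note IH = Suc[of i]
  note [simp] = glD(1,2)[OF IH]
  have "gd \<odot> (idn 1 \<otimes> E k) = gd \<otimes> E k"
    using interchange[of gd "idn 1" "idn 0" "E k"] by simp
  moreover have "((idn 1 \<otimes> E k) \<otimes> (idn 1 \<otimes> E k)) \<odot> D (Suc k) = gd \<otimes> E k"
    using tens_D_Suc[of "idn 1" "idn 1" "E k" k "E k"] by (simp add: tens_id E_E_D del: D.simps)
  moreover have "ge \<odot> (idn 1 \<otimes> E k) = ge \<otimes> E k"
    using interchange[of ge "idn 1" "idn 0" "E k"] by simp
  ultimately have 1: "gl (Suc k) (idn 1 \<otimes> E k)"
    by (simp add: gl_def del: D.simps)
  let ?p = "proj k i"
  have "gd \<odot> (ge \<otimes> ?p) = ge \<otimes> (gd \<odot> ?p)"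
    using interchange[of "idn 0" ge gd ?p] by simp
  moreover have "((ge \<otimes> ?p) \<otimes> (ge \<otimes> ?p)) \<odot> D (Suc k) = ge \<otimes> ((?p \<otimes> ?p) \<odot> D k)"
    using tens_D_Suc[of ge ge ?p k ?p] by (simp add: tens_id ge_ge_gd del: D.simps)
  moreover have "ge \<odot> (ge \<otimes> ?p) = ge \<otimes> E k"
    using interchange[of "idn 0" ge ge ?p] glD(4)[OF IH] by simp
  ultimately have 2: "gl (Suc k) (ge \<otimes> ?p)"
    using glD(3)[OF IH] by (simp add: gl_def del: D.simps)
  show ?case using 1 2 by (simp add: i_def)
qed

fun letter_mor :: "nat \<Rightarrow> letter \<Rightarrow> mor" where
  "letter_mor k (j, b) = (if b then proj k j else gs \<odot> proj k j)"

fun word_mor :: "nat \<Rightarrow> word \<Rightarrow> mor" where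
  "word_mor k [] = one k"
| "word_mor k (l # w) = conv k (letter_mor k l) (word_mor k w)"

lemma gl_letter_mor: "gl k (letter_mor k l)"
  by (cases l) (simp add: gl_proj gl_gs)

lemma gl_word_mor: "gl k (word_mor k w)"
  by (induction w) (simp_all add: gl_one gl_conv gl_letter_mor)

lemmas gl_rules = gl_letter_mor gl_word_mor gl_conv gl_one gl_gs

lemma conv_letter_linv: "conv k (letter_mor k l) (letter_mor k (linv l)) = one k"
  by (cases l) (simp add: linv_def conv_gs_left conv_gs_right gl_proj)

text \<open>Cancelling adjacent inverse letters does not change the convolution product. Hence
  \<open>word_mor\<close> turns multiplication of words with cancellation into convolution.\<close>

lemma word_mor_push: "word_mor k (push l w) = conv k (letter_mor k l) (word_mor k w)"
proof (cases w)
  case (Cons a v)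
  show ?thesis
  proof (cases "a = linv l")
    case True
    have "conv k (letter_mor k l) (conv k (letter_mor k (linv l)) (word_mor k v)) = word_mor k v"
      by (simp add: conv_assoc[symmetric] gl_rules conv_letter_linv conv_one_left)
    with Cons True show ?thesis by (simp add: push_Cons del: push.simps)
  qed (simp add: Cons push_Cons del: push.simps)
qed simp

lemma word_mor_append: "word_mor k (u @ v) = conv k (word_mor k u) (word_mor k v)"
  by (induction u) (simp_all add: conv_one_left gl_rules conv_assoc)

lemma word_mor_wmul: "word_mor k (wmul u v) = conv k (word_mor k u) (word_mor k v)"
  by (induction u) (simp_all add: wmul_Cons word_mor_push conv_one_left gl_rules conv_assoc)

text \<open>Uniqueness of inverses again: the inverse word gives a left inverse of
  \<open>word_mor k w\<close>, the antipode a right inverse.\<close>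

lemma word_mor_winv: "word_mor k (winv w) = gs \<odot> word_mor k w"
proof -
  have inv: "conv k (word_mor k (winv w)) (word_mor k w) = one k"
  proof (induction w)
    case Nil
    show ?case by (simp add: winv_def' conv_one_left gl_rules)
  next
    case (Cons l w)
    have "conv k (letter_mor k (linv l)) (conv k (letter_mor k l) (word_mor k w)) = word_mor k w"
      using conv_letter_linv[of k "linv l"]
      by (simp add: conv_assoc[symmetric] gl_rules conv_one_left)
    with Cons show ?case
      by (simp add: winv_Cons word_mor_append conv_assoc gl_rules conv_one_left)
  qed
  have "word_mor k (winv w) = conv k (word_mor k (winv w)) (conv k (word_mor k w) (gs \<odot> word_mor k w))"
    by (simp add: conv_gs_right gl_rules conv_one_right)
  also have "\<dots> = gs \<odot> word_mor k w"
    by (simp add: conv_assoc[symmetric] inv gl_rules conv_one_left)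
  finally show ?thesis .
qed

section \<open>Tuples in the cartesian structure\<close>

fun tup :: "nat \<Rightarrow> mor list \<Rightarrow> mor" where
  "tup k [] = E k"
| "tup k (f # fs) = (f \<otimes> tup k fs) \<odot> D k"

lemma dom_tup [simp]: "dom (tup k fs) = k"
  by (cases fs) auto

lemma cod_tup [simp]: "\<forall>f \<in> set fs. cod f = 1 \<Longrightarrow> cod (tup k fs) = length fs"
  by (induction fs) auto

text \<open>Coassociativity of \<open>D k\<close> rebrackets the copies.\<close>

lemma tup_append:
  assumes "\<forall>f \<in> set fs. dom f = k"
  shows "tup k (fs @ hs) = (tup k fs \<otimes> tup k hs) \<odot> D k"
  using assms
proof (induction fs)
  case Nil
  have "E k \<otimes> tup k hs = tup k hs \<odot> (E k \<otimes> idn k)"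
    using interchange[of "idn 0" "E k" "tup k hs" "idn k"] by simp
  then show ?case by (simp add: D_counit_left)
next
  case (Cons f fs)
  then have [simp]: "dom f = k" by simp
  have "tup k ((f # fs) @ hs) = (f \<otimes> ((tup k fs \<otimes> tup k hs) \<odot> D k)) \<odot> D k"
    using Cons by simp
  also have "\<dots> = ((f \<otimes> tup k fs) \<otimes> tup k hs) \<odot> ((idn k \<otimes> D k) \<odot> D k)"
    by (simp add: interchange_comp)
  also have "\<dots> = ((f \<otimes> tup k fs) \<otimes> tup k hs) \<odot> ((D k \<otimes> idn k) \<odot> D k)"
    by (simp only: D_coassoc)
  also have "\<dots> = (tup k (f # fs) \<otimes> tup k hs) \<odot> D k"
    by (simp add: interchange_comp del: tens_assoc)
  finally show ?case .
qed

lemma tup_single: "dom f = k \<Longrightarrow> tup k [f] = f"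
proof -
  assume "dom f = k"
  then have "f \<otimes> E k = f \<odot> (idn k \<otimes> E k)"
    using interchange[of f "idn k" "idn 0" "E k"] by simp
  with \<open>dom f = k\<close> show ?thesis by (simp add: D_counit_right)
qed

text \<open>The inductive step of \<open>tup_proj\<close>: all projections but the first discard the
  first wire, and discarding every copy of it amounts to discarding it once.\<close>

lemma tup_ge: "\<forall>f \<in> set fs. dom f = k \<Longrightarrow> tup (Suc k) (map (\<lambda>f. ge \<otimes> f) fs) = ge \<otimes> tup k fs"
proof (induction fs)
  case (Cons f fs)
  then have "tup (Suc k) (map (\<lambda>f. ge \<otimes> f) (f # fs)) = (ge \<otimes> f \<otimes> ge \<otimes> tup k fs) \<odot> D (Suc k)"
    by (simp del: D.simps)
  also have "\<dots> = ge \<otimes> tup k (f # fs)"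
    using tens_D_Suc[of ge ge f k "tup k fs"] Cons.prems by (simp add: tens_id ge_ge_gd del: D.simps)
  finally show ?case .
qed simp

lemma tup_proj: "tup m (map (proj m) [1..<Suc m]) = idn m"
proof (induction m)
  case (Suc m)
  let ?ps = "map (proj m) [1..<Suc m]"
  have "map (proj (Suc m)) [1..<Suc (Suc m)] = (idn 1 \<otimes> E m) # map (proj (Suc m)) (map Suc [1..<Suc m])"
    by (simp only: map_Suc_upt upt_conv_Cons) simp
  also have "map (proj (Suc m)) (map Suc [1..<Suc m]) = map (\<lambda>f. ge \<otimes> f) ?ps"
    by (simp del: upt_Suc)
  finally have "tup (Suc m) (map (proj (Suc m)) [1..<Suc (Suc m)])
      = ((idn 1 \<otimes> E m) \<otimes> (ge \<otimes> tup m ?ps)) \<odot> D (Suc m)"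
    using gl_proj by (simp only: tup.simps) (subst tup_ge, auto simp: gl_def)
  also have "\<dots> = (idn 1 \<otimes> E m \<otimes> ge \<otimes> idn m) \<odot> D (Suc m)"
    by (simp only: Suc tens_assoc)
  also have "\<dots> = idn (Suc m)"
    using tens_D_Suc[of "idn 1" ge "E m" m "idn m"] hopf_axioms(8) D_counit_left[of m]
    by (simp add: tens_id del: D.simps)
  finally show ?case .
qed simp


subsection \<open>Terms are determined by their value at the generators\<close>

definition words_mor :: "nat \<Rightarrow> word list \<Rightarrow> mor" where
  "words_mor k ws = tup k (map (word_mor k) ws)"

lemma dom_words_mor [simp]: "dom (words_mor k ws) = k"
  by (simp add: words_mor_def)

lemma cod_words_mor [simp]: "cod (words_mor k ws) = length ws"
  using gl_word_mor by (simp add: words_mor_def gl_def)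

lemma words_mor_append: "words_mor k (us @ ws) = (words_mor k us \<otimes> words_mor k ws) \<odot> D k"
  using gl_word_mor by (simp add: words_mor_def tup_append gl_def)

lemma words_mor_single: "words_mor k [w] = word_mor k w"
  unfolding words_mor_def using gl_word_mor[of k w] by (simp only: list.map tup_single gl_def)

text \<open>By naturality the braiding of the outputs becomes a braiding of the two copies of the
  input block, which cocommutativity of \<open>D k\<close> absorbs.\<close>

lemma br_words_mor:
  "br (length us) (length ws) \<odot> words_mor k (us @ ws) = words_mor k (ws @ us)"
proof -
  have "br (length us) (length ws) \<odot> (words_mor k us \<otimes> words_mor k ws)
      = (words_mor k ws \<otimes> words_mor k us) \<odot> br k k"
    using br_nat[of "words_mor k us" "words_mor k ws"] by simp
  then show ?thesis
    using comp_cong_left[of "br (length us) (length ws)"]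
    by (simp add: words_mor_append D_cocomm)
qed

lemma mor_words_mor:
  "wf_tm t \<Longrightarrow> length ws = src t \<Longrightarrow>
     abs_mor t \<odot> words_mor k ws = words_mor k (eval t ws)"
proof (induction t arbitrary: ws)
  case (Id n)
  then show ?case by (simp add: idn.abs_eq[symmetric])
next
  case (Br m n)
  then show ?case
    using br_words_mor[of "take m ws" "drop m ws" k] by (simp add: br.abs_eq[symmetric])
next
  case (BrInv m n)
  \<comment> \<open>Exhibiting the input as a braided tuple lets the inverse braiding
    cancel.\<close>
  have "words_mor k ws = br m n \<odot> words_mor k (drop n ws @ take n ws)"
    using br_words_mor[of "drop n ws" "take n ws" k] BrInv by simp
  then show ?case
    using BrInv by (simp add: brinv.abs_eq[symmetric] brinv_br comp_assoc[symmetric] del: comp_assoc)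
next
  case (Gen g)
  show ?case
  proof (cases g)
    case GMu
    then obtain u v where "ws = [u] @ [v]"
      using Gen by (cases ws; cases "tl ws") auto
    then show ?thesis
      using GMu by (simp only: words_mor_append)
        (simp add: words_mor_single word_mor_wmul cv_def gm.abs_eq[symmetric])
  next
    case GUn
    then show ?thesis
      using Gen by (simp add: words_mor_single one_def gu.abs_eq[symmetric]) (simp add: words_mor_def)
  next
    case GDl
    then obtain u where "ws = [u]"
      using Gen by (cases ws) auto
    then show ?thesis
      using GDl glD(3)[OF gl_word_mor] words_mor_append[of k "[u]" "[u]"]
      by (simp add: words_mor_single gd.abs_eq[symmetric])
  next
    case GEp
    then obtain u where "ws = [u]"
      using Gen by (cases ws) auto
    then show ?thesis
      using GEp glD(4)[OF gl_word_mor]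
      by (simp add: words_mor_single ge.abs_eq[symmetric]) (simp add: words_mor_def)
  next
    case GAn
    then obtain u where "ws = [u]"
      using Gen by (cases ws) auto
    then show ?thesis
      using GAn by (simp add: words_mor_single word_mor_winv gs.abs_eq[symmetric])
  qed
next
  case (Comp f g)
  then show ?case by (simp add: comp.abs_eq[symmetric] length_eval)
next
  case (Tens f g)
  let ?us = "take (src f) ws" and ?vs = "drop (src f) ws"
  have "dom (abs_mor f) = src f" "dom (abs_mor g) = src g"
    by (simp_all add: dom.abs_eq)
  moreover have "words_mor k ws = (words_mor k ?us \<otimes> words_mor k ?vs) \<odot> D k"
    using words_mor_append[of k ?us ?vs] by simp
  ultimately have "abs_mor (Tens f g) \<odot> words_mor k ws
      = ((abs_mor f \<odot> words_mor k ?us) \<otimes> (abs_mor g \<odot> words_mor k ?vs)) \<odot> D k"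
    using Tens.prems by (simp add: tens.abs_eq[symmetric] interchange_comp)
  also have "\<dots> = words_mor k (eval (Tens f g) ws)"
    using Tens by (simp add: words_mor_append)
  finally show ?case .
qed

definition gens :: "nat \<Rightarrow> word list" where
  "gens m = map (\<lambda>j. [(j, True)]) [1..<Suc m]"

lemma length_gens [simp]: "length (gens m) = m"
  by (simp add: gens_def)

lemma words_mor_gens: "words_mor m (gens m) = idn m"
  using tup_proj[of m] gl_proj
  by (simp add: words_mor_def gens_def o_def conv_one_right del: upt_Suc)

lemma eval_gens_eq_imp_ideal:
  assumes "typed s m n" "typed t m n" "eval s (gens m) = eval t (gens m)"
  shows "(m, n, df s t :: tm \<Rightarrow> 'k::field) \<in> ideal V_CocHopf"
proof -
  have "abs_mor s = words_mor m (eval s (gens m))" if "typed s m n" for s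
    using that mor_words_mor[of s "gens m" m] by (simp add: typed_iff words_mor_gens dom.abs_eq)
  with assms have "ceq s t"
    using mor.abs_eq_iff by metis
  with ceq_imp_ideal[of s t] assms show ?thesis
    by (simp add: typed_iff)
qed


subsection \<open>Evaluation of the normal forms\<close>

lemma tens_list_simps [simp]:
  "tens_list [] = Id 0" "tens_list (t # ts) = Tens t (tens_list ts)"
  by (simp_all add: tens_list_def)

lemma tens_list_typed [simp]:
  "src (tens_list ts) = sum_list (map src ts)" "tgt (tens_list ts) = sum_list (map tgt ts)"
  "wf_tm (tens_list ts) \<longleftrightarrow> (\<forall>t \<in> set ts. wf_tm t)"
  by (induction ts) auto

lemma eval_tens_list:
  "\<forall>x \<in> set L. length (h x) = src (g x) \<Longrightarrow>
   eval (tens_list (map g L)) (concat (map h L)) = concat (map (\<lambda>x. eval (g x) (h x)) L)"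
  by (induction L) auto

lemma diag_typed [simp]: "wf_tm (diag k) \<and> src (diag k) = 1 \<and> tgt (diag k) = k"
  by (induction k rule: diag.induct) auto

lemma eval_diag: "eval (diag k) [x] = replicate k x"
  by (induction k rule: diag.induct) auto

lemma mult_typed [simp]: "wf_tm (mult k) \<and> src (mult k) = k \<and> tgt (mult k) = 1"
  by (induction k rule: mult.induct) auto

lemma eval_mult: "length xs = k \<Longrightarrow> eval (mult k) xs = [foldl wmul [] xs]"
proof (induction k arbitrary: xs rule: mult.induct)
  case 2
  then show ?case by (cases xs) auto
next
  case (3 k)
  then obtain ys y where "xs = ys @ [y]" "length ys = Suc k"
    by (cases xs rule: rev_cases) auto
  with 3 show ?case by simp
qed simp

lemma foldl_wmul_letters: "reduced w \<Longrightarrow> foldl wmul [] (map (\<lambda>l. [l]) w) = w"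
proof (induction w rule: rev_induct)
  case (snoc l w)
  then have "reduced w"
    by (simp add: reduced_eq_successively successively_append_iff)
  with snoc show ?case by (simp add: wmul_reduced_append)
qed simp

text \<open>The distinct labels only select the braidings, while the wires carry the values
  \<open>f\<close>, which may repeat: all occurrences of one variable carry the same word.\<close>

lemma perm_correct:
  assumes "distinct cur" "distinct ts" "set cur = set ts"
  shows "wf_tm (perm cur ts)" "src (perm cur ts) = length ts" "tgt (perm cur ts) = length ts"
    and "eval (perm cur ts) (map f cur) = map f ts"
proof -
  have "wf_tm (perm cur ts) \<and> src (perm cur ts) = length ts \<and> tgt (perm cur ts) = length ts \<and>
        eval (perm cur ts) (map f cur) = map f ts"
    using assms
  proof (induction ts arbitrary: cur)
    case (Cons t ts)
    then obtain ys zs where cur: "cur = ys @ t # zs" "t \<notin> set ys"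
      by (metis list.set_intros(1) split_list_first)
    then have pos: "pos t cur = length ys" and rm: "remove1 t cur = ys @ zs"
      by (auto simp: pos_def remove1_append takeWhile_append)
    have yz: "distinct (ys @ zs)" "distinct ts" "set (ys @ zs) = set ts"
      using Cons.prems cur by auto
    then have "length (ys @ zs) = length ts"
      by (metis distinct_card)
    with Cons.IH[OF yz] show ?case
      by (simp add: pos rm) (simp add: cur)
  qed simp
  then show "wf_tm (perm cur ts)" "src (perm cur ts) = length ts" "tgt (perm cur ts) = length ts"
    and "eval (perm cur ts) (map f cur) = map f ts" by auto
qed

section \<open>Labels of the occurrences of a variable\<close>

definition letter_count :: "word \<Rightarrow> nat \<Rightarrow> nat" where
  "letter_count L j = length (filter (\<lambda>l. fst l = j) L)"

text \<open>The label of a letter depends only on the letters before it, so this form of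
  \<open>occ_labels\<close> on one word admits induction from the right.\<close>

definition labels :: "word \<Rightarrow> (nat \<times> nat) list" where
  "labels L = map (\<lambda>p. (fst (L ! p), Suc (letter_count (take p L) (fst (L ! p))))) [0..<length L]"

lemma occ_labels_eq: "occ_labels ws = labels (concat ws)"
  by (simp add: occ_labels_def labels_def letter_count_def Let_def)

lemma labels_Nil [simp]: "labels [] = []"
  by (simp add: labels_def)

lemma labels_snoc: "labels (L @ [l]) = labels L @ [(fst l, Suc (letter_count L (fst l)))]"
  by (auto simp: labels_def nth_append)

text \<open>A new last letter takes the next free number of its variable, so the numbers used for
  each variable form an initial segment; distinctness follows too.\<close>

lemma set_labels: "set (labels L) = {(j, r). 1 \<le> r \<and> r \<le> letter_count L j}"
  by (induction L rule: rev_induct) (auto simp: labels_snoc letter_count_def split: if_splits)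

lemma distinct_labels: "distinct (labels L)"
  by (induction L rule: rev_induct) (auto simp: labels_snoc set_labels)

lemma map_fst_labels: "map fst (labels L) = map fst L"
  by (induction L rule: rev_induct) (auto simp: labels_snoc)

lemma sorted_labels_Suc:
  "sorted_labels (Suc m) ws = sorted_labels m ws @ map (Pair (Suc m)) [1..<Suc (occ ws (Suc m))]"
  by (simp add: sorted_labels_def)

lemma set_sorted_labels:
  "set (sorted_labels m ws) = {(j, r). 1 \<le> j \<and> j \<le> m \<and> 1 \<le> r \<and> r \<le> occ ws j}"
  by (fastforce simp: sorted_labels_def simp del: upt_Suc)

lemma distinct_sorted_labels: "distinct (sorted_labels m ws)"
proof (induction m)
  case (Suc m)
  then show ?case
    unfolding sorted_labels_Suc by (auto simp: distinct_map inj_on_def set_sorted_labels)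
qed (simp add: sorted_labels_def)

lemma set_sorted_labels_eq:
  assumes "\<forall>w \<in> set ws. Fword m w"
  shows "set (sorted_labels m ws) = set (occ_labels ws)"
proof -
  have "1 \<le> j \<and> j \<le> m" if "1 \<le> r" "r \<le> occ ws j" for j r
  proof -
    from that have "filter (\<lambda>l. fst l = j) (concat ws) \<noteq> []"
      unfolding occ_def by (metis le_zero_eq list.size(3) not_one_le_zero)
    then obtain l where "l \<in> set (concat ws)" "fst l = j"
      by (auto simp: filter_empty_conv)
    with assms show ?thesis by (auto simp: Fword_def)
  qed
  then show ?thesis
    unfolding set_sorted_labels occ_labels_eq set_labels by (auto simp: occ_def letter_count_def)
qed

text \<open>The layers of \<open>phi_term\<close> are followed from the input: \<open>1\<close>
  copies the generators, \<open>2\<close> permutes, \<open>3\<close> inserts signs, \<open>4\<close>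
  multiplies. Since the words are reduced, no cancellation occurs in \<open>4\<close>.\<close>

lemma phi_term_correct:
  assumes ws: "\<forall>w \<in> set ws. Fword m w"
  shows "typed (phi_term m ws) m (length ws)" "eval (phi_term m ws) (gens m) = ws"
proof -
  note perm = perm_correct[OF distinct_sorted_labels _ set_sorted_labels_eq[OF ws], unfolded occ_labels_eq,
      OF distinct_labels, folded occ_labels_eq]
  have len: "length (occ_labels ws) = length (concat ws)"
    by (simp add: occ_labels_eq labels_def)
  \<comment> \<open>Two distinct lists with the same set have the same length; thus the copying
    layer produces as many wires as there are letters.\<close>
  have "length (sorted_labels m ws) = length (occ_labels ws)"
    using distinct_card[OF distinct_sorted_labels[of m ws]] distinct_card[OF distinct_labels]
    by (simp add: set_sorted_labels_eq[OF ws] occ_labels_eq)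
  moreover have "length (sorted_labels m ws) = sum_list (map (occ ws) [1..<Suc m])"
    by (simp add: sorted_labels_def length_concat o_def del: upt_Suc)
  ultimately have occ: "sum_list (map (occ ws) [1..<Suc m]) = length (concat ws)"
    using len by simp
  show "typed (phi_term m ws) m (length ws)"
    unfolding typed_iff phi_term_def using perm(1-3) len occ
    by (auto simp: o_def length_concat sum_list_triv if_distrib cong: if_cong simp del: upt_Suc)
  have "eval (tens_list (map (\<lambda>j. diag (occ ws j)) [1..<Suc m])) (gens m)
      = concat (map (\<lambda>j. eval (diag (occ ws j)) [[(j, True)]]) [1..<Suc m])"
    using eval_tens_list[of "[1..<Suc m]" "\<lambda>j. [[(j, True)]]" "\<lambda>j. diag (occ ws j)"]
    by (simp add: gens_def concat_map_singleton del: upt_Suc)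
  also have "\<dots> = map (\<lambda>(j, r). [(j, True)]) (sorted_labels m ws)"
    by (simp add: eval_diag sorted_labels_def map_concat o_def map_replicate_const del: upt_Suc)
  finally have 1: "eval (tens_list (map (\<lambda>j. diag (occ ws j)) [1..<Suc m])) (gens m)
      = map (\<lambda>(j, r). [(j, True)]) (sorted_labels m ws)" .
  \<comment> \<open>Here \<open>\<dots>\<close> is the right-hand side of \<open>1\<close>.\<close>
  have 2: "eval (perm (sorted_labels m ws) (occ_labels ws)) \<dots>
      = concat (map (\<lambda>l. [[(fst l, True)]]) (concat ws))"
  proof -
    have "map (\<lambda>(j, r). [(j, True)]) (occ_labels ws) = map (\<lambda>j. [(j, True)]) (map fst (occ_labels ws))"
      by (simp add: case_prod_beta')
    also have "\<dots> = concat (map (\<lambda>l. [[(fst l, True)]]) (concat ws))"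
      unfolding occ_labels_eq map_fst_labels by (simp add: concat_map_singleton o_def)
    finally show ?thesis
      by (simp add: perm(4))
  qed
  have sign: "eval (if snd l then Id 1 else SS) [[(fst l, True)]] = [[l]]" for l :: letter
    by (cases l) (auto simp: winv_def)
  have 3: "eval (tens_list (map (\<lambda>l. if snd l then Id 1 else SS) (concat ws)))
        (concat (map (\<lambda>l. [[(fst l, True)]]) (concat ws)))
      = concat (map (\<lambda>l. [[l]]) (concat ws))"
    by (subst eval_tens_list, simp) (simp only: sign)
  have "concat (map (\<lambda>l. [[l]]) (concat ws)) = concat (map (map (\<lambda>l. [l])) ws)"
    using concat_map_singleton[of "\<lambda>l. [l]" "concat ws"] by (simp only: map_concat)
  then have 4: "eval (tens_list (map (\<lambda>w. mult (length w)) ws)) (concat (map (\<lambda>l. [[l]]) (concat ws))) = ws"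
    using ws by (simp only:) (subst eval_tens_list,
      auto simp: eval_mult foldl_wmul_letters Fword_def concat_map_singleton cong: map_cong)
  show "eval (phi_term m ws) (gens m) = ws"
    unfolding phi_term_def eval.simps 1 2 3 4 ..
qed


subsection \<open>Linear combinations of terms\<close>

text \<open>The linear functional extending \<open>G\<close> from terms, applied to
  \<open>f\<close>. With an indicator function as \<open>G\<close> it extracts coefficients.\<close>

definition lin :: "(tm \<Rightarrow> 'k::field) \<Rightarrow> (tm \<Rightarrow> 'k) \<Rightarrow> 'k" where
  "lin f G = (\<Sum>t | f t \<noteq> 0. f t * G t)"

lemma lin_superset:
  "finite A \<Longrightarrow> {t. f t \<noteq> 0} \<subseteq> A \<Longrightarrow> lin f G = (\<Sum>t\<in>A. f t * G t)"
  unfolding lin_def by (rule sum.mono_neutral_left) auto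

lemma lin_add:
  assumes "finite {t. f t \<noteq> 0}" "finite {t. g t \<noteq> 0}"
  shows "lin (\<lambda>t. f t + g t) G = lin f G + lin g G"
proof -
  \<comment> \<open>Coefficients may cancel in the sum, so all three functionals are computed over
    the union of the supports.\<close>
  let ?A = "{t. f t \<noteq> 0} \<union> {t. g t \<noteq> 0}"
  have "lin h G = (\<Sum>t\<in>?A. h t * G t)" if "{t. h t \<noteq> 0} \<subseteq> ?A" for h
    using that assms by (intro lin_superset) auto
  note A = this
  have "lin (\<lambda>t. f t + g t) G = (\<Sum>t\<in>?A. (f t + g t) * G t)"
    by (rule A) auto
  also have "\<dots> = lin f G + lin g G"
    by (subst (1 2) A) (auto simp: sum.distrib distrib_right)
  finally show ?thesis .
qed

lemma lin_smult: "lin (\<lambda>t. c * f t) G = c * lin f G"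
  by (cases "c = 0") (simp_all add: lin_def sum_distrib_left mult.assoc)

lemma lin_df: "lin (df s t) G = G s - G t"
proof -
  have "lin (df s t) G = (\<Sum>r\<in>{s, t}. df s t r * G r)"
    by (rule lin_superset) (auto simp: df_def lc_def split: if_splits)
  then show ?thesis
    by (cases "s = t") (auto simp: df_def lc_def)
qed

text \<open>Covers \<open>postc\<close>, \<open>prec\<close>, \<open>tensl\<close> and
  \<open>tensr\<close> at once: each transports coefficients along an injective map \<open>c\<close>
  of terms and is zero off its range.\<close>

lemma support_reindex:
  assumes "\<And>t. f' (c t) = f t" "\<And>s. f' s \<noteq> 0 \<Longrightarrow> s \<in> range c"
  shows "{s. f' s \<noteq> 0} = c ` {t. f t \<noteq> 0}"
proof (rule set_eqI)
  fix s
  show "s \<in> {s. f' s \<noteq> 0} \<longleftrightarrow> s \<in> c ` {t. f t \<noteq> 0}"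
  proof (cases "s \<in> range c")
    case True
    then show ?thesis by (auto simp flip: assms(1))
  next
    case False
    then show ?thesis using assms(2) by blast
  qed
qed

lemma lin_reindex:
  assumes "inj c" "\<And>t. f' (c t) = f t" "\<And>s. f' s \<noteq> 0 \<Longrightarrow> s \<in> range c"
  shows "lin f' G = lin f (\<lambda>t. G (c t))"
proof -
  have "{s. f' s \<noteq> 0} = c ` {t. f t \<noteq> 0}"
    using assms(2,3) by (rule support_reindex)
  moreover have "inj_on c {t. f t \<noteq> 0}"
    using assms(1) by (rule inj_on_subset) simp
  ultimately show ?thesis
    unfolding lin_def by (simp add: sum.reindex assms(2))
qed

text \<open>A form of \<open>poly_id\<close> suited to induction over the ideal: with arbitrary
  functions \<open>G\<close> of the value, an outer context is absorbed into
  \<open>G\<close>.\<close>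

definition vanishes :: "nat \<Rightarrow> nat \<Rightarrow> (tm \<Rightarrow> 'k::field) \<Rightarrow> bool" where
  "vanishes m n f \<longleftrightarrow> in_P m n f \<and>
     (\<forall>xs G. length xs = m \<longrightarrow> (\<forall>x \<in> set xs. reduced x) \<longrightarrow> lin f (\<lambda>t. G (eval t xs)) = 0)"

lemma vanishesD:
  "vanishes m n f \<Longrightarrow> length xs = m \<Longrightarrow> \<forall>x \<in> set xs. reduced x \<Longrightarrow> lin f (\<lambda>t. G (eval t xs)) = 0"
  by (simp add: vanishes_def)

text \<open>On the finitely many values attained by the support, every \<open>G\<close> is a
  combination of indicators, and \<open>poly_id\<close> tests exactly these.\<close>

lemma poly_id_iff_vanishes:
  assumes "in_P m n f"
  shows "poly_id m n f \<longleftrightarrow> vanishes m n f"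
proof
  assume "vanishes m n f"
  then have "lin f (\<lambda>t. if eval t xs = ys then 1 else 0) = 0"
    if "length xs = m" "\<forall>x \<in> set xs. reduced x" for xs ys
    using that by (rule vanishesD[where G = "\<lambda>zs. if zs = ys then 1 else 0"])
  moreover have "lin f (\<lambda>t. if eval t xs = ys then 1 else 0)
      = (\<Sum>t | f t \<noteq> 0. if eval t xs = ys then f t else 0)" for xs ys
    unfolding lin_def by (rule sum.cong) auto
  ultimately show "poly_id m n f"
    by (simp add: poly_id_def)
next
  assume f: "poly_id m n f"
  have fin: "finite {t. f t \<noteq> 0}"
    using assms by (simp add: in_P_def)
  have "lin f (\<lambda>t. G (eval t xs)) = 0"
    if xs: "length xs = m" "\<forall>x \<in> set xs. reduced x" for xs G
  proof -
    let ?T = "{t. f t \<noteq> 0}" and ?e = "\<lambda>t. eval t xs"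
    have "lin f (\<lambda>t. G (?e t)) = (\<Sum>t\<in>?T. \<Sum>ys\<in>?e ` ?T. if ?e t = ys then f t * G ys else 0)"
      unfolding lin_def using fin by (intro sum.cong) auto
    also have "\<dots> = (\<Sum>ys\<in>?e ` ?T. G ys * (\<Sum>t\<in>?T. if ?e t = ys then f t else 0))"
      by (subst sum.swap, intro sum.cong refl) (auto simp: sum_distrib_left intro!: sum.cong)
    also have "\<dots> = 0"
      using f xs by (simp add: poly_id_def)
    finally show ?thesis .
  qed
  with assms show "vanishes m n f" by (auto simp: vanishes_def)
qed

lemma vanishes_df:
  assumes "wf_tm s" "wf_tm t" "src s = src t" "tgt s = tgt t"
    and "\<And>xs. length xs = src s \<Longrightarrow> \<forall>x \<in> set xs. reduced x \<Longrightarrow> eval s xs = eval t xs"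
  shows "vanishes (src s) (tgt s) (df s t)"
proof -
  have "finite {r. df s t r \<noteq> (0::'a)}"
    by (rule finite_subset[of _ "{s, t}"]) (auto simp: df_def lc_def split: if_splits)
  then have "in_P (src s) (tgt s) (df s t :: tm \<Rightarrow> 'a)"
    using assms(1-4) by (auto simp: in_P_def typed_iff df_def lc_def split: if_splits)
  with assms(5) show ?thesis
    by (simp add: vanishes_def lin_df)
qed

text \<open>In the hypothesis \<open>eval\<close>, \<open>ys\<close> is the input that reaches the
  inner term and \<open>h\<close> the context around its value.\<close>

lemma vanishes_reindex:
  assumes f: "vanishes m n f" and "inj c" "\<And>t. f' (c t) = f t" "\<And>s. f' s \<noteq> 0 \<Longrightarrow> s \<in> range c"
    and typed: "\<And>t. typed t m n \<Longrightarrow> typed (c t) m' n'"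
    and eval: "\<And>xs. length xs = m' \<Longrightarrow> \<forall>x \<in> set xs. reduced x \<Longrightarrow>
      \<exists>ys h. length ys = m \<and> (\<forall>y \<in> set ys. reduced y) \<and>
        (\<forall>t. typed t m n \<longrightarrow> eval (c t) xs = h (eval t ys))"
  shows "vanishes m' n' f'"
proof -
  have supp: "{s. f' s \<noteq> 0} = c ` {t. f t \<noteq> 0}"
    using assms(3,4) by (rule support_reindex)
  have P: "finite {t. f t \<noteq> 0}" "\<And>t. f t \<noteq> 0 \<Longrightarrow> typed t m n"
    using f by (auto simp: vanishes_def in_P_def)
  have "typed s m' n'" if "f' s \<noteq> 0" for s
  proof -
    from that have "s \<in> c ` {t. f t \<noteq> 0}"
      using supp by blast
    then show ?thesis using P typed by auto
  qed
  then have "in_P m' n' f'"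
    using P unfolding in_P_def supp by simp
  moreover have "lin f' (\<lambda>t. G (eval t xs)) = 0"
    if xs: "length xs = m'" "\<forall>x \<in> set xs. reduced x" for xs G
  proof -
    obtain ys h where ys: "length ys = m" "\<forall>y \<in> set ys. reduced y"
      and h: "\<And>t. typed t m n \<Longrightarrow> eval (c t) xs = h (eval t ys)"
      using eval[OF xs] by (elim exE conjE) (rule that, auto)
    have "lin f' (\<lambda>t. G (eval t xs)) = lin f (\<lambda>t. G (eval (c t) xs))"
      by (rule lin_reindex) (fact assms)+
    also have "\<dots> = lin f (\<lambda>t. G (h (eval t ys)))"
      unfolding lin_def by (rule sum.cong) (simp_all add: P(2) h)
    also have "\<dots> = 0"
      using f ys by (rule vanishesD[where G = "\<lambda>zs. G (h zs)"])
    finally show ?thesis .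
  qed
  ultimately show ?thesis by (auto simp: vanishes_def)
qed

text \<open>The Hopf axioms become the group laws of the free group; associativity, the right unit
  and inverses hold because the inputs are reduced.\<close>

lemma coc_rel_eval:
  assumes "(s, t) \<in> coc_rel" "length xs = src s" "\<forall>x \<in> set xs. reduced x"
  shows "eval s xs = eval t xs"
  using assms(1) unfolding coc_rel_def
  by (elim insertE emptyE; use assms(2,3) in \<open>simp; elim conjE; hypsubst;
      auto simp: length_Suc_conv numeral_eq_Suc wmul_assoc wmul_Nil_right wmul_winv_left wmul_winv_right\<close>)

lemma ideal_vanishes: "(m, n, f) \<in> ideal V_CocHopf \<Longrightarrow> vanishes m n f"
proof (induction rule: ideal.induct)
  case (id_gen m n v)
  then show ?case
    using coc_rel_wf coc_rel_eval by (auto simp: V_CocHopf_eq intro!: vanishes_df)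
next
  case (id_eqv t m n t')
  then show ?case
    using eqv_sound[of t t'] vanishes_df[of t t'] by (auto simp: df_def typed_iff)
next
  case (id_zero m n)
  then show ?case by (simp add: vanishes_def in_P_def lin_def)
next
  case (id_add m n f g)
  then have "finite {t. f t \<noteq> 0}" "finite {t. g t \<noteq> 0}"
    by (auto simp: vanishes_def in_P_def)
  moreover from this have "finite {t. f t + g t \<noteq> 0}"
    by (rule_tac finite_subset[of _ "{t. f t \<noteq> 0} \<union> {t. g t \<noteq> 0}"]) auto
  moreover have "typed t m n" if "f t + g t \<noteq> 0" for t
    using that id_add.IH by (cases "f t = 0") (auto simp: vanishes_def in_P_def)
  ultimately show ?case
    using id_add.IH by (simp add: vanishes_def in_P_def lin_add)
next
  case (id_smult m n f c)
  then have "finite {t. c * f t \<noteq> 0}"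
    by (auto simp: vanishes_def in_P_def)
  then show ?case
    using id_smult by (auto simp: vanishes_def in_P_def lin_smult)
next
  case (id_postc m n f h p)
  have "\<exists>ys g. length ys = m \<and> (\<forall>y \<in> set ys. reduced y) \<and>
        (\<forall>t. typed t m n \<longrightarrow> eval (Comp h t) xs = g (eval t ys))"
    if "length xs = m" "\<forall>x \<in> set xs. reduced x" for xs
    using that by (intro exI[of _ xs] exI[of _ "eval h"]) auto
  then show ?case
    by (rule_tac vanishes_reindex[OF id_postc.IH, of "Comp h"])
      (use id_postc in \<open>auto simp: inj_def postc_def typed_iff split: tm.splits if_splits\<close>)
next
  case (id_prec m n f h p)
  have "\<exists>ys g. length ys = m \<and> (\<forall>y \<in> set ys. reduced y) \<and>
        (\<forall>t. typed t m n \<longrightarrow> eval (Comp t h) xs = g (eval t ys))"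
    if "length xs = p" "\<forall>x \<in> set xs. reduced x" for xs
    \<comment> \<open>The inner term now sees \<open>eval h xs\<close>, which is again a tuple of
      reduced words.\<close>
    using that id_prec.hyps eval_reduced[of h xs]
    by (intro exI[of _ "eval h xs"] exI[of _ "\<lambda>zs. zs"]) (auto simp: typed_iff length_eval)
  then show ?case
    by (rule_tac vanishes_reindex[OF id_prec.IH, of "\<lambda>t. Comp t h"])
      (use id_prec in \<open>auto simp: inj_def prec_def typed_iff split: tm.splits if_splits\<close>)
next
  case (id_tensl m n f h p q)
  have "\<exists>ys g. length ys = m \<and> (\<forall>y \<in> set ys. reduced y) \<and>
        (\<forall>t. typed t m n \<longrightarrow> eval (Tens h t) xs = g (eval t ys))"
    if "length xs = p + m" "\<forall>x \<in> set xs. reduced x" for xs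
    using that id_tensl.hyps
    by (intro exI[of _ "drop p xs"] exI[of _ "\<lambda>zs. eval h (take p xs) @ zs"])
      (auto simp: typed_iff dest: in_set_dropD)
  then show ?case
    by (rule_tac vanishes_reindex[OF id_tensl.IH, of "Tens h"])
      (use id_tensl in \<open>auto simp: inj_def tensl_def typed_iff split: tm.splits if_splits\<close>)
next
  case (id_tensr m n f h p q)
  have "\<exists>ys g. length ys = m \<and> (\<forall>y \<in> set ys. reduced y) \<and>
        (\<forall>t. typed t m n \<longrightarrow> eval (Tens t h) xs = g (eval t ys))"
    if "length xs = m + p" "\<forall>x \<in> set xs. reduced x" for xs
    using that id_tensr.hyps
    by (intro exI[of _ "take m xs"] exI[of _ "\<lambda>zs. zs @ eval h (drop m xs)"])
      (auto simp: typed_iff dest: in_set_takeD)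
  then show ?case
    by (rule_tac vanishes_reindex[OF id_tensr.IH, of "\<lambda>t. Tens t h"])
      (use id_tensr in \<open>auto simp: inj_def tensr_def typed_iff split: tm.splits if_splits\<close>)
qed


subsection \<open>Linear combinations of normal forms\<close>

lemma phi_lin_superset:
  "finite A \<Longrightarrow> {ws. a ws \<noteq> 0} \<subseteq> A \<Longrightarrow>
   phi_lin m a t = (\<Sum>ws\<in>A. if phi_term m ws = t then a ws else 0)"
  unfolding phi_lin_def by (rule sum.mono_neutral_left) auto

lemma phi_lin_linear:
  assumes "in_A m n a" "in_A m n b"
  shows "phi_lin m (\<lambda>ws. a ws + c * b ws) = (\<lambda>t. phi_lin m a t + c * phi_lin m b t)"
proof
  fix t
  let ?A = "{ws. a ws \<noteq> 0} \<union> {ws. b ws \<noteq> 0}"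
  have fin: "finite ?A"
    using assms by (simp add: in_A_def)
  have "phi_lin m (\<lambda>ws. a ws + c * b ws) t
      = (\<Sum>ws\<in>?A. if phi_term m ws = t then a ws + c * b ws else 0)"
    by (rule phi_lin_superset[OF fin]) auto
  also have "\<dots> = (\<Sum>ws\<in>?A. (if phi_term m ws = t then a ws else 0) +
      c * (if phi_term m ws = t then b ws else 0))"
    by (rule sum.cong) auto
  also have "\<dots> = phi_lin m a t + c * phi_lin m b t"
    unfolding sum.distrib sum_distrib_left[symmetric]
    by (subst (1 2) phi_lin_superset[OF fin]) auto
  finally show "phi_lin m (\<lambda>ws. a ws + c * b ws) t = phi_lin m a t + c * phi_lin m b t" .
qed

lemma phi_lin_support: "{t. phi_lin m a t \<noteq> 0} \<subseteq> phi_term m ` {ws. a ws \<noteq> 0}"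
proof
  fix t
  assume "t \<in> {t. phi_lin m a t \<noteq> 0}"
  from this[unfolded mem_Collect_eq phi_lin_def]
  obtain ws where "ws \<in> {ws. a ws \<noteq> 0}" "(if phi_term m ws = t then a ws else 0) \<noteq> 0"
    by (rule sum.not_neutral_contains_not_neutral)
  then show "t \<in> phi_term m ` {ws. a ws \<noteq> 0}"
    by (auto split: if_splits)
qed

lemma in_P_phi_lin:
  assumes "in_A m n a"
  shows "in_P m n (phi_lin m a)"
proof -
  have "typed t m n" if "phi_lin m a t \<noteq> 0" for t
  proof -
    from that phi_lin_support[of m a] obtain ws where "t = phi_term m ws" "a ws \<noteq> 0"
      by auto
    with assms phi_term_correct(1)[of ws m] show ?thesis
      by (simp add: in_A_def)
  qed
  moreover have "finite {t. phi_lin m a t \<noteq> 0}"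
    using phi_lin_support by (rule finite_subset) (use assms in \<open>simp add: in_A_def\<close>)
  ultimately show ?thesis by (simp add: in_P_def)
qed

lemma lin_phi_lin:
  assumes "in_A m n a"
  shows "lin (phi_lin m a) G = (\<Sum>ws | a ws \<noteq> 0. a ws * G (phi_term m ws))"
proof -
  let ?W = "{ws. a ws \<noteq> 0}"
  have fin: "finite ?W" using assms by (simp add: in_A_def)
  then have "lin (phi_lin m a) G = (\<Sum>t\<in>phi_term m ` ?W. phi_lin m a t * G t)"
    by (intro lin_superset phi_lin_support) simp
  also have "\<dots> = (\<Sum>t\<in>phi_term m ` ?W. \<Sum>ws\<in>?W. if phi_term m ws = t then a ws * G t else 0)"
    by (auto simp: phi_lin_def sum_distrib_right intro!: sum.cong)
  also have "\<dots> = (\<Sum>ws\<in>?W. \<Sum>t\<in>phi_term m ` ?W. if phi_term m ws = t then a ws * G t else 0)"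
    by (rule sum.swap)
  also have "\<dots> = (\<Sum>ws\<in>?W. a ws * G (phi_term m ws))"
    using fin by (intro sum.cong) auto
  finally show ?thesis .
qed

text \<open>\<open>phi_term m ws\<close> takes the value \<open>ws\<close> at the generators, so the
  indicator of \<open>ws\<close> reads off exactly one coefficient.\<close>

lemma phi_lin_coeff:
  assumes "in_A m n a"
  shows "lin (phi_lin m a) (\<lambda>t. if eval t (gens m) = ws then 1 else 0) = a ws"
proof -
  have "lin (phi_lin m a) (\<lambda>t. if eval t (gens m) = ws then 1 else 0)
      = (\<Sum>vs | a vs \<noteq> 0. if vs = ws then a vs else 0)"
    unfolding lin_phi_lin[OF assms]
    by (rule sum.cong) (use assms phi_term_correct(2)[of _ m] in \<open>auto simp: in_A_def\<close>)
  also have "\<dots> = a ws"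
    using assms by (simp add: in_A_def)
  finally show ?thesis .
qed

definition nf :: "nat \<Rightarrow> (tm \<Rightarrow> 'k::field) \<Rightarrow> word list \<Rightarrow> 'k" where
  "nf m f ws = lin f (\<lambda>t. if eval t (gens m) = ws then 1 else 0)"

lemma gens_Fword: "\<forall>w \<in> set (gens m). Fword m w"
  by (auto simp: gens_def Fword_def)

lemma gens_reduced: "\<forall>w \<in> set (gens m). reduced w"
  using gens_Fword by (auto simp: Fword_def)

lemma typed_eval_gens:
  assumes "typed t m n"
  shows "length (eval t (gens m)) = n" "\<forall>w \<in> set (eval t (gens m)). Fword m w"
  using assms length_eval[of t "gens m"] eval_Fword[of t "gens m" m] gens_Fword
  by (auto simp: typed_iff)

lemma nf_support: "{ws. nf m f ws \<noteq> 0} \<subseteq> (\<lambda>t. eval t (gens m)) ` {t. f t \<noteq> 0}"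
proof
  fix ws
  assume "ws \<in> {ws. nf m f ws \<noteq> 0}"
  from this[unfolded mem_Collect_eq nf_def lin_def]
  obtain t where "t \<in> {t. f t \<noteq> 0}" "f t * (if eval t (gens m) = ws then 1 else 0) \<noteq> 0"
    by (rule sum.not_neutral_contains_not_neutral)
  then show "ws \<in> (\<lambda>t. eval t (gens m)) ` {t. f t \<noteq> 0}"
    by (auto split: if_splits)
qed

lemma in_A_nf:
  assumes "in_P m n f"
  shows "in_A m n (nf m f)"
proof -
  have "length ws = n \<and> (\<forall>w \<in> set ws. Fword m w)" if "nf m f ws \<noteq> 0" for ws
    using that nf_support[of m f] assms typed_eval_gens[of _ m n] by (auto simp: in_P_def)
  moreover have "finite {ws. nf m f ws \<noteq> 0}"
    using nf_support by (rule finite_subset) (use assms in \<open>simp add: in_P_def\<close>)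
  ultimately show ?thesis by (simp add: in_A_def)
qed

lemma ideal_sum:
  assumes "finite T" "\<And>t. t \<in> T \<Longrightarrow> (m, n, h t) \<in> ideal V"
  shows "(m, n, \<lambda>s. \<Sum>t\<in>T. c t * h t s) \<in> ideal V"
  using assms
proof (induction T)
  case empty
  show ?case by (simp add: ideal.id_zero)
next
  case (insert t T)
  then show ?case
    using ideal.id_add[OF ideal.id_smult[of m n "h t" V "c t"], of "\<lambda>s. \<Sum>t\<in>T. c t * h t s"] by simp
qed

text \<open>Replace each term \<open>t\<close> of \<open>f\<close> by the normal form with the same
  value at the generators. Each replacement costs a member of the ideal, and \<open>phi\<close>
  shows that collecting the replacements gives \<open>phi_lin m (nf m f)\<close>.\<close>

lemma nf_ideal:
  fixes f :: "tm \<Rightarrow> 'k::field"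
  assumes "in_P m n f"
  shows "(m, n, \<lambda>s. f s - phi_lin m (nf m f) s) \<in> ideal V_CocHopf"
proof -
  let ?T = "{t. f t \<noteq> 0}" and ?e = "\<lambda>t. eval t (gens m)"
  have fin: "finite ?T" and typed: "\<And>t. t \<in> ?T \<Longrightarrow> typed t m n"
    using assms by (auto simp: in_P_def)
  have phi: "phi_lin m (nf m f) s = (\<Sum>t\<in>?T. f t * lc (phi_term m (?e t)) s)" for s
  proof -
    have "phi_lin m (nf m f) s = (\<Sum>ws\<in>?e ` ?T. if phi_term m ws = s then nf m f ws else 0)"
      using fin by (intro phi_lin_superset nf_support) simp
    also have "\<dots> = (\<Sum>ws\<in>?e ` ?T. \<Sum>t\<in>?T. if ?e t = ws then f t * lc (phi_term m ws) s else 0)"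
    proof (rule sum.cong)
      fix ws
      show "(if phi_term m ws = s then nf m f ws else 0)
          = (\<Sum>t\<in>?T. if ?e t = ws then f t * lc (phi_term m ws) s else 0)"
        by (cases "s = phi_term m ws") (auto simp: nf_def lin_def lc_def intro!: sum.cong sum.neutral)
    qed simp
    also have "\<dots> = (\<Sum>t\<in>?T. \<Sum>ws\<in>?e ` ?T. if ?e t = ws then f t * lc (phi_term m ws) s else 0)"
      by (rule sum.swap)
    also have "\<dots> = (\<Sum>t\<in>?T. f t * lc (phi_term m (?e t)) s)"
      using fin by (intro sum.cong) auto
    finally show ?thesis .
  qed
  have f: "(\<Sum>t\<in>?T. f t * lc t s) = f s" for s
  proof -
    have "(\<Sum>t\<in>?T. f t * lc t s) = (\<Sum>t\<in>?T. if s = t then f t else 0)"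
      by (rule sum.cong) (auto simp: lc_def)
    then show ?thesis using fin by simp
  qed
  have "f s - phi_lin m (nf m f) s = (\<Sum>t\<in>?T. f t * df t (phi_term m (?e t)) s)" for s
    by (simp only: phi f df_def right_diff_distrib sum_subtractf)
  moreover have "(m, n, df t (phi_term m (?e t)) :: tm \<Rightarrow> 'k) \<in> ideal V_CocHopf" if "t \<in> ?T" for t
    using typed[OF that] typed_eval_gens[OF typed[OF that]] phi_term_correct[of "?e t" m]
    by (intro eval_gens_eq_imp_ideal) auto
  then have "(m, n, \<lambda>s. \<Sum>t\<in>?T. f t * df t (phi_term m (?e t)) s) \<in> ideal V_CocHopf"
    by (intro ideal_sum fin)
  ultimately show ?thesis by simp
qed

section \<open>Classes in the quotient, bijectivity and polynomial identities\<close>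

lemma cls_eqI:
  assumes "(m, n, \<lambda>s. f s - g s) \<in> ideal V"
  shows "cls V m n f = cls V m n g"
  using assms by (auto simp: cls_def intro: ideal_diff ideal_uminus)

lemma cls_eqD:
  assumes "cls V m n f = cls V m n g" "in_P m n g"
  shows "(m, n, \<lambda>s. f s - g s) \<in> ideal V"
proof -
  \<comment> \<open>Classes contain only combinations satisfying \<open>in_P\<close>, hence the
    assumption on \<open>g\<close>.\<close>
  have "g \<in> cls V m n g"
    using assms(2) by (simp add: cls_def ideal.id_zero)
  with assms(1) have "g \<in> cls V m n f" by simp
  then show ?thesis by (simp add: cls_def)
qed

lemma phi_lin_ideal_imp_eq:
  assumes a: "in_A m n a" and b: "in_A m n b"
    and ideal: "(m, n, \<lambda>s. phi_lin m a s - phi_lin m b s) \<in> ideal V_CocHopf"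
  shows "a = b"
proof
  fix ws
  let ?G = "\<lambda>t. if eval t (gens m) = ws then 1 else 0"
  have "finite {t. phi_lin m a t \<noteq> 0}" "finite {t. - 1 * phi_lin m b t \<noteq> 0}"
    using in_P_phi_lin[OF a] in_P_phi_lin[OF b] by (simp_all add: in_P_def)
  \<comment> \<open>The same difference is computed twice: by linearity it is the difference of the
    coefficients at \<open>ws\<close>, and as a member of the ideal it is zero.\<close>
  then have "lin (\<lambda>s. phi_lin m a s + - 1 * phi_lin m b s) ?G = a ws - b ws"
    by (subst lin_add) (simp_all only: lin_smult phi_lin_coeff[OF a] phi_lin_coeff[OF b], simp)
  moreover have "lin (\<lambda>s. phi_lin m a s - phi_lin m b s) ?G = 0"
    using ideal_vanishes[OF ideal] length_gens gens_reduced
    by (rule vanishesD[where G = "\<lambda>zs. if zs = ws then 1 else 0"])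
  ultimately show "a ws = b ws" by simp
qed

theorem mainTheorem8:
  fixes k_type :: "'k::field itself"
  shows
  "(\<forall>m n.
      (\<forall>(a :: word list \<Rightarrow> 'k). in_A m n a \<longrightarrow> in_P m n (phi_lin m a))
    \<and> (\<forall>(a :: word list \<Rightarrow> 'k) b c. in_A m n a \<longrightarrow> in_A m n b \<longrightarrow>
          phi_lin m (\<lambda>ws. a ws + c * b ws) = (\<lambda>t. phi_lin m a t + c * phi_lin m b t))
    \<and> bij_betw (\<lambda>(a :: word list \<Rightarrow> 'k). cls V_CocHopf m n (phi_lin m a))
               {a. in_A m n a} (PV V_CocHopf m n))
   \<and> (\<forall>(m, n, v) \<in> (V_CocHopf :: (nat \<times> nat \<times> (tm \<Rightarrow> 'k)) set). poly_id m n v)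
   \<and> (\<forall>m n (f :: tm \<Rightarrow> 'k). in_P m n f \<longrightarrow> poly_id m n f \<longrightarrow> (m, n, f) \<in> ideal V_CocHopf)"
proof (intro conjI allI impI)
  fix m n
  let ?V = "V_CocHopf :: (nat \<times> nat \<times> (tm \<Rightarrow> 'k)) set"
  show "in_P m n (phi_lin m a)" if "in_A m n a" for a :: "word list \<Rightarrow> 'k"
    using that by (rule in_P_phi_lin)
  show "phi_lin m (\<lambda>ws. a ws + c * b ws) = (\<lambda>t. phi_lin m a t + c * phi_lin m b t)"
    if "in_A m n a" "in_A m n b" for a b :: "word list \<Rightarrow> 'k" and c
    using that by (rule phi_lin_linear)
  show "bij_betw (\<lambda>a. cls ?V m n (phi_lin m a)) {a. in_A m n a} (PV ?V m n)"
    unfolding bij_betw_def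
  proof
    show "inj_on (\<lambda>a. cls ?V m n (phi_lin m a)) {a. in_A m n a}"
      by (rule inj_onI) (auto intro: phi_lin_ideal_imp_eq cls_eqD in_P_phi_lin)
    \<comment> \<open>Surjectivity: \<open>nf m f\<close> is a preimage of the class of
      \<open>f\<close>.\<close>
    have "cls ?V m n f \<in> (\<lambda>a. cls ?V m n (phi_lin m a)) ` {a. in_A m n a}" if "in_P m n f" for f
      using cls_eqI[OF nf_ideal[OF that]] in_A_nf[OF that] by blast
    then show "(\<lambda>a. cls ?V m n (phi_lin m a)) ` {a. in_A m n a} = PV ?V m n"
      using in_P_phi_lin by (fastforce simp: PV_def)
  qed
next
  show "\<forall>(m, n, v) \<in> (V_CocHopf :: (nat \<times> nat \<times> (tm \<Rightarrow> 'k)) set). poly_id m n v"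
    using ideal_vanishes[OF ideal.id_gen] poly_id_iff_vanishes vanishes_def by blast
next
  fix m n and f :: "tm \<Rightarrow> 'k"
  assume f: "in_P m n f" and "poly_id m n f"
  then have "vanishes m n f"
    by (simp add: poly_id_iff_vanishes)
  \<comment> \<open>The identity is evaluated at the single tuple of generators, where it already
    annihilates every coefficient of the normal form.\<close>
  then have "nf m f ws = 0" for ws
    using vanishesD[OF _ length_gens gens_reduced, where G = "\<lambda>zs. if zs = ws then 1 else 0"]
    by (simp add: nf_def)
  then have "phi_lin m (nf m f) s = 0" for s
    by (simp add: phi_lin_def)
  with nf_ideal[OF f] show "(m, n, f) \<in> ideal V_CocHopf"
    by simp
qed

end
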